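(* Let $\mathscr{S}$ be an arbitrary semiring. For all integers $r,n\ge 1$, the following reductions hold: (1) $\mathrm{SReach}(r,n)$ reduces to $\mathrm{SReach}(2,rn)$; (2) $\mathrm{VReach}(r,n)$ reduces to $\mathrm{VReach}(2,rn)$; (3) $\mathrm{MReach}(r,n)$ reduces to $\mathrm{MReach}(2,rn)$; (4) $\mathrm{VReach}(r,n)$ reduces to $\mathrm{MReach}(r+1,k)$, where $k=n+1$ if the target vector $\eta$ is nonzero, and $k=n+3$ otherwise; (5) $\mathrm{SReach}(r,n)$ reduces to $\mathrm{VReach}(r+1,k)$, where $k=n+1$ if the target scalar $\gamma$ is nonzero, and $k=n+3$ otherwise; (6) $\mathrm{SReach}(r,n)$ reduces to $\mathrm{MReach}(r+1,k)$, where $k=n+2$ if the target scalar $\gamma$ is nonzero, and $k=n+5$ otherwise. Moreover, the value of the target $\gamma$ is preserved in reduction (1) (instances with target $\gamma$ are reduced to instances with the same target $\gamma$), and the zero or nonzero character of the target $\eta$ (respectively $M$) is preserved in reduction (2) (respectively (3)).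
   Context: A semiring $\mathscr{S}$ is a set with an addition and a multiplication such that $\mathscr{S}$ is a commutative monoid for addition, a monoid for multiplication, multiplication distributes on the left and on the right over addition, and the zero element is left and right absorbing for multiplication. Problems over $\mathscr{S}$ (for $r$ generators of dimension $n$): - $\mathrm{MReach}(r,n)$ (matrix reachability): given $n\times n$ matrices $A_1,\dots,A_r$ and $M$ with entries in $\mathscr{S}$, is there a finite sequence $1\le i_1,\dots,i_k\le r$ with $k\ge 1$ such that $A_{i_1}\cdots A_{i_k}=M$? - $\mathrm{VReach}(r,n)$ (vector reachability): given $n\times n$ matrices $A_1,\dots,A_r$ and $1\times n$ matrices $\alpha,\eta$ with entries in $\mathscr{S}$, is there a finite sequence $1\le i_1,\dots,i_k\le r$ with $k\ge1$ such that $\alpha A_{i_1}\cdots A_{i_k}=\eta$? - $\mathrm{SReach}(r,n)$ (scalar reachability): given $n\times n$ matrices $A_1,\dots,A_r$, a $1\times n$ matrix $\alpha$, an $n\times 1$ matrix $\beta$, all with entries in $\mathscr{S}$, and $\gamma\in\mathscr{S}$, is there a finite sequence $1\le i_1,\dots,i_k\le r$ with $k\ge1$ such that $\alpha A_{i_1}\cdots A_{i_k}\beta=\gamma$? Reduction: the elements of $\mathscr{S}$ are assumed to be represented in some effective way, and oracles are available which take representations of $a,b\in\mathscr{S}$ and return representations of $a+b$ and $ab$, and the truth value of $a=b$. A problem $P'$ reduces to a problem $P$ if there is an algorithm solving $P'$ using an oracle solving $P$ together with the oracles computing the sum and the product and checking equality in $\mathscr{S}$ (a form of Turing reduction). In (4)--(6),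 the reduction is meant for the restriction of the first problem to instances whose target is nonzero, respectively zero, with the corresponding value of $k$. *)

theory Defs
  imports "Jordan_Normal_Form.Matrix"
begin

section \<open>Decision problems over a semiring\<close>

text \<open>
  The sort \<open>{semiring_0, monoid_mult}\<close> is used for semirings instead of \<open>semiring_1\<close>, because
  the latter also demands \<open>0 \<noteq> 1\<close> and hence excludes the trivial semiring.

  \<open>entries\<close> lists the semiring elements that make up an instance. For each of the problems below
  (with fixed parameters) this list has a fixed length and determines the instance.
\<close>

record ('i, 'a) problem =
  instances :: "'i set"
  entries :: "'i \<Rightarrow> 'a list"
  solvable :: "'i \<Rightarrow> bool"

definition restrict_to :: "('i, 'a) problem \<Rightarrow> ('i \<Rightarrow> bool) \<Rightarrow> ('i, 'a) problem" where
  "restrict_to P T = P\<lparr>instances := {x \<in> instances P. T x}\<rparr>"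

definition mat_entries :: "'a mat \<Rightarrow> 'a list" where
  "mat_entries A = concat (mat_to_list A)"

definition mat_product :: "nat \<Rightarrow> 'a :: {semiring_0, monoid_mult} mat list \<Rightarrow> 'a mat" where
  "mat_product n Ms = foldr (*) Ms (1\<^sub>m n)"

text \<open>The generators \<open>A\<^sub>1, \<dots>, A\<^sub>r\<close> are the list entries \<open>As ! 0, \<dots>, As ! (r - 1)\<close>.\<close>

definition generators :: "nat \<Rightarrow> nat \<Rightarrow> 'a mat list set" where
  "generators r n = {As. length As = r \<and> set As \<subseteq> carrier_mat n n}"

definition index_words :: "nat \<Rightarrow> nat list set" where
  "index_words r = {w. w \<noteq> [] \<and> set w \<subseteq> {..<r}}"

definition MReach :: "nat \<Rightarrow> nat \<Rightarrow> ('a :: {semiring_0, monoid_mult} mat list \<times> 'a mat, 'a) problem"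
  where
  "MReach r n =
    \<lparr>instances = {(As, M). As \<in> generators r n \<and> M \<in> carrier_mat n n},
     entries = (\<lambda>(As, M). concat (map mat_entries As) @ mat_entries M),
     solvable = (\<lambda>(As, M). \<exists>w \<in> index_words r. mat_product n (map ((!) As) w) = M)\<rparr>"

definition VReach ::
  "nat \<Rightarrow> nat \<Rightarrow> ('a :: {semiring_0, monoid_mult} mat list \<times> 'a mat \<times> 'a mat, 'a) problem" where
  "VReach r n =
    \<lparr>instances = {(As, \<alpha>, \<eta>).
        As \<in> generators r n \<and> \<alpha> \<in> carrier_mat 1 n \<and> \<eta> \<in> carrier_mat 1 n},
     entries = (\<lambda>(As, \<alpha>, \<eta>).
        concat (map mat_entries As) @ mat_entries \<alpha> @ mat_entries \<eta>),
     solvable = (\<lambda>(As, \<alpha>, \<eta>).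
        \<exists>w \<in> index_words r. \<alpha> * mat_product n (map ((!) As) w) = \<eta>)\<rparr>"

definition SReach ::
  "nat \<Rightarrow> nat \<Rightarrow> ('a :: {semiring_0, monoid_mult} mat list \<times> 'a mat \<times> 'a mat \<times> 'a, 'a) problem"
  where
  "SReach r n =
    \<lparr>instances = {(As, \<alpha>, \<beta>, \<gamma>).
        As \<in> generators r n \<and> \<alpha> \<in> carrier_mat 1 n \<and> \<beta> \<in> carrier_mat n 1},
     entries = (\<lambda>(As, \<alpha>, \<beta>, \<gamma>).
        concat (map mat_entries As) @ mat_entries \<alpha> @ mat_entries \<beta> @ [\<gamma>]),
     solvable = (\<lambda>(As, \<alpha>, \<beta>, \<gamma>).
        \<exists>w \<in> index_words r. (\<alpha> * mat_product n (map ((!) As) w) * \<beta>) $$ (0, 0) = \<gamma>)\<rparr>"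

definition mtarget :: "'a mat list \<times> 'a mat \<Rightarrow> 'a mat" where
  "mtarget = (\<lambda>(As, M). M)"

definition vtarget :: "'a mat list \<times> 'a mat \<times> 'a mat \<Rightarrow> 'a mat" where
  "vtarget = (\<lambda>(As, \<alpha>, \<eta>). \<eta>)"

definition starget :: "'a mat list \<times> 'a mat \<times> 'a mat \<times> 'a \<Rightarrow> 'a" where
  "starget = (\<lambda>(As, \<alpha>, \<beta>, \<gamma>). \<gamma>)"

definition is_zero_mat :: "'a :: zero mat \<Rightarrow> bool" where
  "is_zero_mat A \<longleftrightarrow> A = 0\<^sub>m (dim_row A) (dim_col A)"


section \<open>Algorithms with oracles\<close>

text \<open>
  Algorithms are partial recursive functions relative to four oracles. Semiring elements are
  represented by natural numbers (codes of finite strings); \<open>oracle_sum\<close>, \<open>oracle_prod\<close> and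
  \<open>oracle_eq\<close> act on such representations, and \<open>oracle_query\<close> receives the list of representations
  of the entries of an instance of the problem to which one reduces.
\<close>

record oracles =
  oracle_sum :: "nat \<Rightarrow> nat \<Rightarrow> nat"
  oracle_prod :: "nat \<Rightarrow> nat \<Rightarrow> nat"
  oracle_eq :: "nat \<Rightarrow> nat \<Rightarrow> bool"
  oracle_query :: "nat list \<Rightarrow> bool"

datatype algorithm =
    Zero
  | Succ
  | Proj nat
  | Comp algorithm "algorithm list"
  | PrimRec algorithm algorithm
  | Minimize algorithm
  | Sum_Oracle
  | Prod_Oracle
  | Eq_Oracle
  | Query_Oracle

text \<open>
  \<open>computes orc f xs y Q\<close>: on input \<open>xs\<close>, the algorithm \<open>f\<close> halts with output \<open>y\<close>, and \<open>Q\<close> is the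
  set of all arguments on which \<open>oracle_query\<close> was called during the computation.
\<close>

inductive computes :: "oracles \<Rightarrow> algorithm \<Rightarrow> nat list \<Rightarrow> nat \<Rightarrow> nat list set \<Rightarrow> bool"
  and computes_list ::
    "oracles \<Rightarrow> algorithm list \<Rightarrow> nat list \<Rightarrow> nat list \<Rightarrow> nat list set \<Rightarrow> bool"
  for orc :: oracles where
  zero: "computes orc Zero xs 0 {}"
| succ: "computes orc Succ [x] (Suc x) {}"
| proj: "i < length xs \<Longrightarrow> computes orc (Proj i) xs (xs ! i) {}"
| comp: "computes_list orc gs xs ys Q \<Longrightarrow> computes orc f ys z R \<Longrightarrow>
    computes orc (Comp f gs) xs z (Q \<union> R)"
| rec_0: "computes orc f xs y Q \<Longrightarrow> computes orc (PrimRec f g) (0 # xs) y Q"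
| rec_Suc: "computes orc (PrimRec f g) (n # xs) y Q \<Longrightarrow> computes orc g (n # y # xs) z R \<Longrightarrow>
    computes orc (PrimRec f g) (Suc n # xs) z (Q \<union> R)"
| minimize: "(\<And>m. m < n \<Longrightarrow> computes orc f (m # xs) (Suc (v m)) (R m)) \<Longrightarrow>
    computes orc f (n # xs) 0 Q \<Longrightarrow>
    computes orc (Minimize f) xs n ((\<Union>m<n. R m) \<union> Q)"
| sum_oracle: "computes orc Sum_Oracle [x, y] (oracle_sum orc x y) {}"
| prod_oracle: "computes orc Prod_Oracle [x, y] (oracle_prod orc x y) {}"
| eq_oracle: "computes orc Eq_Oracle [x, y] (of_bool (oracle_eq orc x y)) {}"
| query_oracle: "computes orc Query_Oracle xs (of_bool (oracle_query orc xs)) {xs}"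
| nil: "computes_list orc [] xs [] {}"
| cons: "computes orc g xs y Q \<Longrightarrow> computes_list orc gs xs ys R \<Longrightarrow>
    computes_list orc (g # gs) xs (y # ys) (Q \<union> R)"

inductive_cases computes_elims:
  "computes orc Zero xs y Q"
  "computes orc Succ xs y Q"
  "computes orc (Proj i) xs y Q"
  "computes orc (Comp f gs) xs y Q"
  "computes orc (PrimRec f g) (0 # xs) y Q"
  "computes orc (PrimRec f g) (Suc n # xs) y Q"
  "computes orc (Minimize f) xs y Q"
  "computes orc Sum_Oracle xs y Q"
  "computes orc Prod_Oracle xs y Q"
  "computes orc Eq_Oracle xs y Q"
  "computes orc Query_Oracle xs y Q"
  "computes_list orc [] xs ys Q"
  "computes_list orc (g # gs) xs ys Q"

lemma computes_deterministic:
  "computes orc f xs y Q \<Longrightarrow> computes orc f xs y' Q' \<Longrightarrow> y = y' \<and> Q = Q'"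
  "computes_list orc gs xs ys R \<Longrightarrow> computes_list orc gs xs ys' R' \<Longrightarrow> ys = ys' \<and> R = R'"
proof (induction arbitrary: y' Q' and ys' R' rule: computes_computes_list.inducts)
  case (comp gs xs ys Q f z R)
  from comp.prems obtain ys2 Q2 R2 where
    *: "Q' = Q2 \<union> R2" "computes_list orc gs xs ys2 Q2" "computes orc f ys2 y' R2"
    by (rule computes_elims(4))
  have "ys = ys2 \<and> Q = Q2" by (rule comp.IH(2)[OF *(2)])
  with * comp.IH(4)[of y' R2] show ?case by simp
next
  case (rec_0 f xs y Q g)
  from rec_0.prems have "computes orc f xs y' Q'" by (rule computes_elims(5))
  then show ?case by (rule rec_0.IH(2))
next
  case (rec_Suc f g n xs y Q z R)
  from rec_Suc.prems obtain y2 Q2 R2 where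
    *: "Q' = Q2 \<union> R2" "computes orc (PrimRec f g) (n # xs) y2 Q2"
      "computes orc g (n # y2 # xs) y' R2"
    by (rule computes_elims(6))
  have "y = y2 \<and> Q = Q2" by (rule rec_Suc.IH(2)[OF *(2)])
  with * rec_Suc.IH(4)[of y' R2] show ?case by simp
next
  case (minimize n f xs v R Q)
  from minimize.prems show ?case
  proof (rule computes_elims(7))
    fix v' R2 Q2
    assume Q': "Q' = (\<Union>m<y'. R2 m) \<union> Q2"
      and lt: "\<And>m. m < y' \<Longrightarrow> computes orc f (m # xs) (Suc (v' m)) (R2 m)"
      and halt: "computes orc f (y' # xs) 0 Q2"
    have "\<not> y' < n" using minimize.IH(2)[OF _ halt] by auto
    moreover have "\<not> n < y'" using minimize.IH(4)[OF lt] by auto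
    ultimately have eq: "y' = n" by simp
    have "R m = R2 m" if "m < n" for m
      using minimize.IH(2)[OF that lt] eq that by simp
    moreover have "Q = Q2" using minimize.IH(4)[of 0 Q2] halt eq by simp
    ultimately show ?thesis using eq Q' by simp
  qed
next
  case (cons g xs y Q gs ys R)
  from cons.prems obtain y2 Q2 ys2 R2 where
    *: "ys' = y2 # ys2" "R' = Q2 \<union> R2" "computes orc g xs y2 Q2"
      "computes_list orc gs xs ys2 R2"
    by (rule computes_elims(13))
  from * cons.IH(2)[OF *(3)] cons.IH(4)[OF *(4)] show ?case by simp
qed (auto elim: computes_elims(1-3) computes_elims(8-12))


section \<open>Reductions\<close>

text \<open>
  \<open>\<nu> c = Some a\<close> means that \<open>c\<close> represents \<open>a\<close>. An element may have several representations, not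
  every number need represent an element, and the set of representations need not be decidable.
\<close>

type_synonym 'a representation = "nat \<Rightarrow> 'a option"

definition total_representation :: "'a representation \<Rightarrow> bool" where
  "total_representation \<nu> \<longleftrightarrow> (\<forall>a. \<exists>c. \<nu> c = Some a)"

definition represents :: "'a representation \<Rightarrow> nat list \<Rightarrow> 'a list \<Rightarrow> bool" where
  "represents \<nu> cs as \<longleftrightarrow> list_all2 (\<lambda>c a. \<nu> c = Some a) cs as"

definition semiring_oracles ::
  "'a :: {semiring_0, monoid_mult} representation \<Rightarrow> oracles \<Rightarrow> bool" where
  "semiring_oracles \<nu> orc \<longleftrightarrow>
    (\<forall>c d a b. \<nu> c = Some a \<longrightarrow> \<nu> d = Some b \<longrightarrow>
      \<nu> (oracle_sum orc c d) = Some (a + b) \<and>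
      \<nu> (oracle_prod orc c d) = Some (a * b) \<and>
      (oracle_eq orc c d \<longleftrightarrow> a = b))"

definition problem_oracle :: "'a representation \<Rightarrow> ('i, 'a) problem \<Rightarrow> oracles \<Rightarrow> bool" where
  "problem_oracle \<nu> P orc \<longleftrightarrow>
    (\<forall>x \<in> instances P. \<forall>cs. represents \<nu> cs (entries P x) \<longrightarrow>
      (oracle_query orc cs \<longleftrightarrow> solvable P x))"

text \<open>
  The oracle for \<open>P\<close> is unspecified outside the instances of \<open>P\<close>, so the algorithm may only query
  it on representations of instances of \<open>P\<close>. The relation \<open>T\<close> constrains which instances \<open>z\<close> of \<open>P\<close>
  may be queried on input \<open>x\<close>.
\<close>

definition reduces_within ::
  "('i \<Rightarrow> 'j \<Rightarrow> bool) \<Rightarrow> 'a :: {semiring_0, monoid_mult} representation \<Rightarrow>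
   ('i, 'a) problem \<Rightarrow> ('j, 'a) problem \<Rightarrow> bool" where
  "reduces_within T \<nu> P' P \<longleftrightarrow>
    (\<exists>f. \<forall>orc. semiring_oracles \<nu> orc \<longrightarrow> problem_oracle \<nu> P orc \<longrightarrow>
      (\<forall>x \<in> instances P'. \<forall>cs. represents \<nu> cs (entries P' x) \<longrightarrow>
        (\<exists>Q. computes orc f cs (of_bool (solvable P' x)) Q \<and>
          (\<forall>q \<in> Q. \<exists>z \<in> instances P. represents \<nu> q (entries P z) \<and> T x z))))"

definition reduces_to ::
  "'a :: {semiring_0, monoid_mult} representation \<Rightarrow>
   ('i, 'a) problem \<Rightarrow> ('j, 'a) problem \<Rightarrow> bool" where
  "reduces_to \<nu> P' P \<longleftrightarrow> reduces_within (\<lambda>x z. True) \<nu> P' P"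

end

theory Submission
  imports Defs
begin

text \<open>
  An instance enters its reachability problem only through the set of nonempty products of its
  generators, \<open>products (set As)\<close>. Each reduction therefore rests on one comparison: the
  products of the new generators that can meet the new target correspond to the products \<open>Q\<close> of the
  old generators that meet the old one.

  \<^bold>\<open>Two generators.\<close> The \<open>r * n\<close> coordinates form \<open>r\<close> blocks, the states of an automaton. The
  letter \<open>X\<close> leads from state \<open>s\<close> to state \<open>0\<close> and applies \<open>A\<^sub>s\<close>. The letter \<open>Y\<close> leads from \<open>s\<close> to
  \<open>s + 1\<close> and applies nothing, except that it leads from the last state to \<open>0\<close> and applies a matrix
  \<open>B\<close>. From state \<open>0\<close> the word \<open>Y\<^sup>s X\<close> then acts as \<open>A\<^sub>s\<close> (\<open>simulate\<close>), and conversely every word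
  applies a nonempty product or ends in a state other than \<open>0\<close> (\<open>track\<close>). With
  \<open>B = A\<^sub>r\<^sub>-\<^sub>1\<close> this settles scalars (the words that have applied nothing are made harmless by
  letting the final vector apply \<open>A\<^sub>0\<close> in the states other than \<open>0\<close>), vectors (the target sits in
  block \<open>0\<close>), and the zero matrix: if \<open>P\<close> kills block row \<open>0\<close>, then \<open>X P = 0\<close>. A nonzero matrix
  target also needs control of the other block rows. With \<open>B = 0\<close> the word \<open>Y\<^sup>r\<^sup>-\<^sup>1 X\<close> kills them
  and acts as the last generator on block row \<open>0\<close>, so it handles the products whose first factor is the last
  generator; one asks this question for all \<open>r\<close> rotations of the list of generators.

  \<^bold>\<open>Passing between the problems.\<close> Suppose \<open>V U = 1\<close>, \<open>E E = E\<close> and \<open>V E U = 0\<close>. Then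
  \<open>A \<mapsto> U A V\<close> is multiplicative and \<open>U A V E U B V = 0\<close>, so a product of the generators \<open>U A V\<close> and
  \<open>E\<close> is \<open>0\<close>, \<open>E\<close> or \<open>U Q V\<close> with an optional \<open>E\<close> on either side (\<open>products_with_switch\<close>). In
  coordinates split as \<open>p + n + q\<close> take \<open>U\<close> to be the column of blocks \<open>\<alpha>, 1, 0\<close>, \<open>V\<close> the row of
  blocks \<open>0, 1, \<beta>\<close> and \<open>E = diag(1, 0, 1)\<close>. Then \<open>E U Q V E\<close> is zero outside its upper right block,
  which is \<open>\<alpha> Q \<beta>\<close>; variants with one \<open>E\<close> isolate \<open>\<alpha> Q\<close> or \<open>\<xi> Q \<beta>\<close>. A nonzero target tells these
  products from the parasitic ones \<open>0\<close> and \<open>E\<close>. A zero target is made nonzero by replacing \<open>A\<close>, \<open>\<alpha>\<close>,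
  \<open>\<beta>\<close> and the target by their direct sums with \<open>1\<close>; this enlarges \<open>n\<close> and the borders by one each,
  which is the origin of \<open>n + 3\<close> and \<open>n + 5\<close>.

  Where \<open>0 = 1\<close> all matrices of a given shape are equal, every instance is solvable, and the constant
  algorithm is a reduction.

  \<^bold>\<open>Effectivity.\<close> The quantities and questions that an algorithm can handle form classes with
  closure properties (\<open>computable\<close>, \<open>decidable_within\<close>). The new instances arise from the
  old ones by sums, products and constants, and the answer is a Boolean combination of queries and
  equality tests, so the closure properties yield the algorithms.
\<close>

section \<open>Matrices over a semiring\<close>

text \<open>
  Side conditions on dimensions, unlike membership in \<open>carrier_mat\<close>, mention no intermediate size, so
  these laws can serve as conditional rewrite rules.
\<close>
lemma mult_mat_assoc:
  fixes A B C :: "'a :: semiring_0 mat"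
  assumes "dim_col A = dim_row B" and "dim_col B = dim_row C"
  shows "(A * B) * C = A * (B * C)"
proof (rule assoc_mult_mat)
  show "A \<in> carrier_mat (dim_row A) (dim_row B)" using assms(1) by (intro carrier_matI) auto
  show "B \<in> carrier_mat (dim_row B) (dim_row C)" using assms(2) by (intro carrier_matI) auto
qed (rule carrier_mat_triv)

lemma add_mult_mat_distrib:
  fixes A B C :: "'a :: semiring_0 mat"
  assumes "dim_row A = dim_row B" and "dim_col A = dim_col B" and "dim_col A = dim_row C"
  shows "(A + B) * C = A * C + B * C"
proof (rule add_mult_distrib_mat)
  show "A \<in> carrier_mat (dim_row B) (dim_row C)" using assms(1,3) by (intro carrier_matI) auto
  show "B \<in> carrier_mat (dim_row B) (dim_row C)" using assms(2,3) by (intro carrier_matI) auto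
qed (rule carrier_mat_triv)

lemma mult_add_mat_distrib:
  fixes A B C :: "'a :: semiring_0 mat"
  assumes "dim_row B = dim_row C" and "dim_col B = dim_col C" and "dim_col A = dim_row B"
  shows "A * (B + C) = A * B + A * C"
proof (rule mult_add_distrib_mat)
  show "A \<in> carrier_mat (dim_row A) (dim_row C)" using assms(1,3) by (intro carrier_matI) auto
  show "B \<in> carrier_mat (dim_row C) (dim_col C)" using assms(1,2) by (intro carrier_matI) auto
qed (rule carrier_mat_triv)

lemma add_zero_mat:
  fixes A :: "'a :: comm_monoid_add mat"
  assumes "A \<in> carrier_mat m n"
  shows "A + 0\<^sub>m m n = A" and "0\<^sub>m m n + A = A"
  using assms by simp_all

text \<open>
  Rows (columns) \<open>k, \<dots>, k + m - 1\<close> of the identity matrix of size \<open>N\<close>. Multiplying by them extracts or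
  places blocks, which turns all computations with block matrices below into algebra with the
  relations \<open>unit_rows_mult_unit_cols\<close>.
\<close>
definition unit_rows :: "nat \<Rightarrow> nat \<Rightarrow> nat \<Rightarrow> 'a :: {zero, one} mat" where
  "unit_rows N k m = mat m N (\<lambda>(i, j). if j = k + i then 1 else 0)"

definition unit_cols :: "nat \<Rightarrow> nat \<Rightarrow> nat \<Rightarrow> 'a :: {zero, one} mat" where
  "unit_cols N k m = mat N m (\<lambda>(i, j). if i = k + j then 1 else 0)"

lemma dim_unit [simp]:
  "dim_row (unit_rows N k m) = m" "dim_col (unit_rows N k m) = N"
  "dim_row (unit_cols N k m) = N" "dim_col (unit_cols N k m) = m"
  by (simp_all add: unit_rows_def unit_cols_def)

lemma unit_carrier [simp]:
  "unit_rows N k m \<in> carrier_mat m N" "unit_cols N k m \<in> carrier_mat N m"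
  by (simp_all add: unit_rows_def unit_cols_def)

lemma unit_rows_mult:
  fixes W :: "'a :: {semiring_0, monoid_mult} mat"
  assumes "k + m \<le> dim_row W" and "N = dim_row W"
  shows "unit_rows N k m * W = mat m (dim_col W) (\<lambda>(i, j). W $$ (k + i, j))"
proof (rule eq_matI, goal_cases)
  case (1 i j)
  have "(\<Sum>l = 0..<N. (if l = k + i then 1 else 0) * W $$ (l, j))
      = (\<Sum>l = 0..<N. if l = k + i then W $$ (l, j) else 0)"
    by (rule sum.cong) auto
  with 1 assms show ?case
    by (simp add: unit_rows_def scalar_prod_def)
qed simp_all

lemma mult_unit_cols:
  fixes W :: "'a :: {semiring_0, monoid_mult} mat"
  assumes "k + m \<le> dim_col W" and "N = dim_col W"
  shows "W * unit_cols N k m = mat (dim_row W) m (\<lambda>(i, j). W $$ (i, k + j))"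
proof (rule eq_matI, goal_cases)
  case (1 i j)
  have "(\<Sum>l = 0..<N. W $$ (i, l) * (if l = k + j then 1 else 0))
      = (\<Sum>l = 0..<N. if l = k + j then W $$ (i, l) else 0)"
    by (rule sum.cong) auto
  with 1 assms show ?case
    by (simp add: unit_cols_def scalar_prod_def)
qed simp_all

lemma mult_unit_rows:
  fixes W :: "'a :: {semiring_0, monoid_mult} mat"
  assumes "dim_col W = m"
  shows "W * unit_rows N k m
    = mat (dim_row W) N (\<lambda>(i, j). if k \<le> j \<and> j < k + m then W $$ (i, j - k) else 0)"
proof (rule eq_matI, goal_cases)
  case (1 i j)
  have "(\<Sum>l = 0..<m. W $$ (i, l) * (if j = k + l then 1 else 0))
      = (\<Sum>l = 0..<m. if l = j - k then if k \<le> j then W $$ (i, l) else 0 else 0)"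
    by (rule sum.cong) auto
  with 1 assms show ?case
    by (simp add: unit_rows_def scalar_prod_def) auto
qed simp_all

lemma one_eq_unit: "1\<^sub>m n = unit_rows n 0 n" "1\<^sub>m n = unit_cols n 0 n"
  by (auto simp: unit_rows_def unit_cols_def)

text \<open>
  The sort includes the semiring with \<open>0 = 1\<close>, which is not a \<open>semiring_1\<close>.
\<close>
lemma mult_one_mat [simp]:
  fixes A :: "'a :: {semiring_0, monoid_mult} mat"
  shows "dim_row A = n \<Longrightarrow> 1\<^sub>m n * A = A" "dim_col A = n \<Longrightarrow> A * 1\<^sub>m n = A"
proof -
  show "1\<^sub>m n * A = A" if "dim_row A = n"
    unfolding one_eq_unit(1) using that by (subst unit_rows_mult) (auto intro!: eq_matI)
  show "A * 1\<^sub>m n = A" if "dim_col A = n"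
    unfolding one_eq_unit(2) using that by (subst mult_unit_cols) (auto intro!: eq_matI)
qed

lemma unit_rows_mult_unit_cols:
  "k + m \<le> N \<Longrightarrow>
    unit_rows N k m * unit_cols N k m = (1\<^sub>m m :: 'a :: {semiring_0, monoid_mult} mat)"
  "k + m \<le> N \<Longrightarrow> k + m \<le> k' \<or> k' + m' \<le> k \<Longrightarrow>
    unit_rows N k m * unit_cols N k' m' = (0\<^sub>m m m' :: 'a :: {semiring_0, monoid_mult} mat)"
  by (subst unit_rows_mult; force simp: unit_cols_def intro!: eq_matI)+

lemma unit_rows_mult_unit_cols_mult:
  fixes W :: "'a :: {semiring_0, monoid_mult} mat"
  shows
  "k + m \<le> N \<Longrightarrow> dim_row W = m \<Longrightarrow> unit_rows N k m * (unit_cols N k m * W) = W"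
  "k + m \<le> N \<Longrightarrow> k + m \<le> k' \<or> k' + m' \<le> k \<Longrightarrow> dim_row W = m' \<Longrightarrow>
    unit_rows N k m * (unit_cols N k' m' * W) = 0\<^sub>m m (dim_col W)"
  by (simp_all add: mult_mat_assoc[symmetric] unit_rows_mult_unit_cols)

lemma eq_mat_iff_unit_rows:
  fixes W W' :: "'a :: {semiring_0, monoid_mult} mat"
  assumes "W \<in> carrier_mat (r * n) m" and "W' \<in> carrier_mat (r * n) m"
  shows "W = W' \<longleftrightarrow>
    (\<forall>s < r. unit_rows (r * n) (s * n) n * W = unit_rows (r * n) (s * n) n * W')"
proof (intro iffI eq_matI)
  fix i j assume *: "\<forall>s < r. unit_rows (r * n) (s * n) n * W = unit_rows (r * n) (s * n) n * W'"
    and ij: "i < dim_row W'" "j < dim_col W'"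
  have n: "n > 0" using ij assms by (cases n) auto
  have s: "i div n < r" using ij assms by (simp add: less_mult_imp_div_less)
  then have "(i div n + 1) * n \<le> r * n" by (intro mult_right_mono) auto
  then have le: "i div n * n + n \<le> r * n" by simp
  from s * have "(unit_rows (r * n) (i div n * n) n * W) $$ (i mod n, j)
      = (unit_rows (r * n) (i div n * n) n * W') $$ (i mod n, j)" by simp
  then show "W $$ (i, j) = W' $$ (i, j)"
    using assms ij le n by (simp add: unit_rows_mult)
qed (use assms in auto)


section \<open>Nonempty products\<close>

inductive_set products :: "'a :: semiring_0 mat set \<Rightarrow> 'a mat set" for S where
  base: "A \<in> S \<Longrightarrow> A \<in> products S"
| step: "A \<in> S \<Longrightarrow> P \<in> products S \<Longrightarrow> A * P \<in> products S"

lemma products_carrier: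
  assumes "S \<subseteq> carrier_mat n n" and "P \<in> products S"
  shows "P \<in> carrier_mat n n"
  using assms(2) by induction (use assms(1) in auto)

lemma products_mult:
  assumes "S \<subseteq> carrier_mat n n" and "P \<in> products S" and "Q \<in> products S"
  shows "P * Q \<in> products S"
  using assms(2)
proof induction
  case (step A P)
  have "A * P * Q = A * (P * Q)"
    using step products_carrier[OF assms(1)] assms by (intro assoc_mult_mat[of _ n n _ n _ n]) auto
  with step show ?case by (auto intro: products.step)
qed (use assms in \<open>auto intro: products.step\<close>)

lemma ex_index_words_iff:
  fixes As :: "'a :: {semiring_0, monoid_mult} mat list"
  assumes "As \<in> generators r n"
  shows "(\<exists>w \<in> index_words r. R (mat_product n (map ((!) As) w))) \<longleftrightarrow>
    (\<exists>P \<in> products (set As). R P)"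
proof -
  have word: "mat_product n (map ((!) As) w) \<in> products (set As)"
    if "w \<noteq> []" "set w \<subseteq> {..<r}" for w
    using that
  proof (induction w rule: induct_list012)
    case (2 i)
    then have "As ! i \<in> set As" using assms by (auto simp: generators_def)
    moreover from this have "dim_col (As ! i) = n" using assms by (auto simp: generators_def)
    ultimately show ?case by (simp add: mat_product_def products.base)
  next
    case (3 i j w)
    then have "mat_product n (map ((!) As) (j # w)) \<in> products (set As)" "As ! i \<in> set As"
      using assms by (auto simp: generators_def)
    from products.step[OF this(2,1)] show ?case by (simp add: mat_product_def)
  qed auto
  have "\<exists>w \<in> index_words r. mat_product n (map ((!) As) w) = P" if "P \<in> products (set As)" for P
    using that
  proof induction
    case (base A)
    then obtain i where "i < r" "As ! i = A"
      using assms by (auto simp: generators_def in_set_conv_nth)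
    moreover have "dim_col A = n" using base assms by (auto simp: generators_def)
    ultimately show ?case
      by (intro bexI[of _ "[i]"]) (auto simp: mat_product_def index_words_def)
  next
    case (step A P)
    then obtain i where "i < r" "As ! i = A"
      using assms by (auto simp: generators_def in_set_conv_nth)
    moreover obtain w where "w \<in> index_words r" "mat_product n (map ((!) As) w) = P"
      using step by auto
    ultimately show ?case
      by (intro bexI[of _ "i # w"]) (auto simp: mat_product_def index_words_def)
  qed
  with word show ?thesis unfolding index_words_def by blast
qed


section \<open>Switching a bordered semigroup on and off\<close>

text \<open>
  By induction, multiplying by one more generator on the left. The relation \<open>V E U = 0\<close> makes a factor
  \<open>E\<close> between two factors of the form \<open>U A V\<close> fatal; hence \<open>E\<close> survives only at the ends, and there it
  is idempotent.
\<close>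
lemma products_with_switch:
  fixes U V E :: "'a :: {semiring_0, monoid_mult} mat"
  assumes U: "U \<in> carrier_mat N n" and V: "V \<in> carrier_mat n N" and E: "E \<in> carrier_mat N N"
    and VU: "V * U = 1\<^sub>m n" and EE: "E * E = E" and VEU: "V * (E * U) = 0\<^sub>m n n"
    and S: "S \<subseteq> carrier_mat n n"
    and P: "P \<in> products (insert E ((\<lambda>A. U * A * V) ` S))"
  shows "P = 0\<^sub>m N N \<or> P = E \<or>
    (\<exists>Q \<in> products S. \<exists>L \<in> {1\<^sub>m N, E}. \<exists>R \<in> {1\<^sub>m N, E}. P = L * (U * Q * V) * R)"
  using P
proof induction
  case (base G)
  then show ?case
  proof
    assume "G \<in> (\<lambda>A. U * A * V) ` S"
    then obtain A where A: "A \<in> S" "G = 1\<^sub>m N * (U * A * V) * 1\<^sub>m N" using U V by auto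
    then show ?thesis by (blast intro: products.base)
  qed simp
next
  case (step G P)
  note dims = carrier_matD[OF U] carrier_matD[OF V] carrier_matD[OF E]
  from step.IH consider "P = 0\<^sub>m N N" | "P = E" | Q L R where "Q \<in> products S"
    "L \<in> {1\<^sub>m N, E}" "R \<in> {1\<^sub>m N, E}" "P = L * (U * Q * V) * R" by blast
  then show ?case
  proof cases
    case 1
    have "dim_col G = N" using step.hyps dims by auto
    with 1 have "G * P = 0\<^sub>m (dim_row G) N" by (auto intro!: eq_matI)
    moreover have "dim_row G = N" using step.hyps dims by auto
    ultimately show ?thesis by simp
  next
    case 2
    from step.hyps(1) show ?thesis
    proof
      assume "G = E" with 2 EE show ?thesis by simp
    next
      assume "G \<in> (\<lambda>A. U * A * V) ` S"
      then obtain A where "A \<in> S" "G * P = 1\<^sub>m N * (U * A * V) * E" using 2 dims by auto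
      then show ?thesis by (blast intro: products.base)
    qed
  next
    case (3 Q L R)
    have Q: "dim_row Q = n" "dim_col Q = n" using products_carrier[OF S 3(1)] by auto
    have LR: "dim_row L = N" "dim_col L = N" "dim_row R = N" using 3 dims by auto
    from step.hyps(1) show ?thesis
    proof
      assume "G = E"
      moreover have "E * L = E" using 3(2) EE dims by auto
      ultimately have "G * P = E * (U * Q * V) * R"
        using 3(4) dims Q LR by (simp flip: mult_mat_assoc)
      with 3 show ?thesis by blast
    next
      assume "G \<in> (\<lambda>A. U * A * V) ` S"
      then obtain A where A: "A \<in> S" "G = U * A * V" by auto
      have A': "dim_row A = n" "dim_col A = n" using A(1) S by auto
      have GP: "G * P = U * (A * (V * (L * U) * (Q * V))) * R"
        unfolding A 3(4) using A' Q LR dims by (simp add: mult_mat_assoc)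
      consider "L = 1\<^sub>m N" | "L = E" using 3(2) by auto
      then have "G * P = 0\<^sub>m N (dim_col R) \<or> G * P = 1\<^sub>m N * (U * (A * Q) * V) * R"
      proof cases
        case 1
        with GP VU A' Q LR dims show ?thesis by (simp add: mult_mat_assoc)
      next
        case 2
        with GP VEU A' Q LR dims show ?thesis by simp
      qed
      moreover have "dim_col R = N" using 3 dims by auto
      ultimately show ?thesis using 3 products.step[OF A(1) 3(1)] by auto
    qed
  qed
qed

text \<open>
  The factors \<open>U\<close>, \<open>V\<close> and the switch \<open>E\<close>: \<open>U A V\<close> is the block matrix with rows \<open>(0, \<alpha> A, \<alpha> A \<beta>)\<close>,
  \<open>(0, A, A \<beta>)\<close> and \<open>(0, 0, 0)\<close>.
\<close>
definition border_entry :: "nat \<Rightarrow> nat \<Rightarrow> nat \<Rightarrow> 'a :: {semiring_0, monoid_mult} mat \<Rightarrow> 'a mat" where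
  "border_entry p n q \<alpha> =
    unit_cols (p + n + q) 0 p * \<alpha> + unit_cols (p + n + q) p n"

definition border_exit :: "nat \<Rightarrow> nat \<Rightarrow> nat \<Rightarrow> 'a :: {semiring_0, monoid_mult} mat \<Rightarrow> 'a mat" where
  "border_exit p n q \<beta> =
    unit_rows (p + n + q) p n + \<beta> * unit_rows (p + n + q) (p + n) q"

definition border_switch :: "nat \<Rightarrow> nat \<Rightarrow> nat \<Rightarrow> 'a :: {semiring_0, monoid_mult} mat" where
  "border_switch p n q =
    unit_cols (p + n + q) 0 p * unit_rows (p + n + q) 0 p +
    unit_cols (p + n + q) (p + n) q * unit_rows (p + n + q) (p + n) q"

text \<open>
  The coordinates are split into an upper part of size \<open>p\<close>, a middle part of size \<open>n\<close> on which the
  original matrices act, and a lower part of size \<open>q\<close>. Unprimed \<open>top\<close>, \<open>mid\<close>, \<open>bot\<close> project onto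
  the parts, their primed versions are the embeddings.
\<close>
locale border =
  fixes p n q N :: nat and \<alpha> \<beta> :: "'a :: {semiring_0, monoid_mult} mat"
    and top mid bot top' mid' bot' U V E :: "'a mat"
  assumes \<alpha>: "\<alpha> \<in> carrier_mat p n" and \<beta>: "\<beta> \<in> carrier_mat n q"
  defines "N \<equiv> p + n + q"
    and "top \<equiv> unit_rows N 0 p" and "mid \<equiv> unit_rows N p n" and "bot \<equiv> unit_rows N (p + n) q"
    and "top' \<equiv> unit_cols N 0 p" and "mid' \<equiv> unit_cols N p n" and "bot' \<equiv> unit_cols N (p + n) q"
    and "U \<equiv> border_entry p n q \<alpha>" and "V \<equiv> border_exit p n q \<beta>" and "E \<equiv> border_switch p n q"
begin

lemma dims [simp]:
  "dim_row \<alpha> = p" "dim_col \<alpha> = n" "dim_row \<beta> = n" "dim_col \<beta> = q"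
  "dim_row top = p" "dim_col top = N" "dim_row mid = n" "dim_col mid = N"
  "dim_row bot = q" "dim_col bot = N"
  "dim_row top' = N" "dim_col top' = p" "dim_row mid' = N" "dim_col mid' = n"
  "dim_row bot' = N" "dim_col bot' = q"
  "dim_row U = N" "dim_col U = n" "dim_row V = n" "dim_col V = N" "dim_row E = N" "dim_col E = N"
  using \<alpha> \<beta> by (simp_all add: top_def mid_def bot_def top'_def mid'_def bot'_def U_def V_def E_def
      border_entry_def border_exit_def border_switch_def N_def)

lemma orthogonal [simp]:
  "top * top' = 1\<^sub>m p" "mid * mid' = 1\<^sub>m n" "bot * bot' = 1\<^sub>m q"
  "top * mid' = 0\<^sub>m p n" "top * bot' = 0\<^sub>m p q" "mid * top' = 0\<^sub>m n p"
  "mid * bot' = 0\<^sub>m n q" "bot * top' = 0\<^sub>m q p" "bot * mid' = 0\<^sub>m q n"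
  by (simp_all add: top_def mid_def bot_def top'_def mid'_def bot'_def N_def
      unit_rows_mult_unit_cols)

lemma orthogonal_mult [simp]:
  "dim_row W = p \<Longrightarrow> top * (top' * W) = W"
  "dim_row W = n \<Longrightarrow> mid * (mid' * W) = W"
  "dim_row W = q \<Longrightarrow> bot * (bot' * W) = W"
  "dim_row W = n \<Longrightarrow> top * (mid' * W) = 0\<^sub>m p (dim_col W)"
  "dim_row W = q \<Longrightarrow> top * (bot' * W) = 0\<^sub>m p (dim_col W)"
  "dim_row W = p \<Longrightarrow> mid * (top' * W) = 0\<^sub>m n (dim_col W)"
  "dim_row W = q \<Longrightarrow> mid * (bot' * W) = 0\<^sub>m n (dim_col W)"
  "dim_row W = p \<Longrightarrow> bot * (top' * W) = 0\<^sub>m q (dim_col W)"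
  "dim_row W = n \<Longrightarrow> bot * (mid' * W) = 0\<^sub>m q (dim_col W)"
  by (simp_all add: mult_mat_assoc[symmetric])

lemma U_eq: "U = top' * \<alpha> + mid'"
  and V_eq: "V = mid + \<beta> * bot"
  and E_eq: "E = top' * top + bot' * bot"
  by (simp_all add: top_def mid_def bot_def top'_def mid'_def bot'_def U_def V_def E_def
      border_entry_def border_exit_def border_switch_def N_def)

lemmas expand = U_eq V_eq E_eq add_mult_mat_distrib mult_add_mat_distrib mult_mat_assoc

lemma zero_add [simp]:
  "dim_row A = k \<Longrightarrow> dim_col A = l \<Longrightarrow> A + 0\<^sub>m k l = (A :: 'a mat)"
  "dim_row A = k \<Longrightarrow> dim_col A = l \<Longrightarrow> 0\<^sub>m k l + A = (A :: 'a mat)"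
  by (auto intro: add_zero_mat carrier_matI)

lemma relations:
  "V * U = 1\<^sub>m n" "E * E = E" "V * (E * U) = 0\<^sub>m n n"
  "top * U = \<alpha>" "mid * U = 1\<^sub>m n" "V * bot' = \<beta>" "V * mid' = 1\<^sub>m n"
  "top * E = top" "E * bot' = bot'" "mid * E = 0\<^sub>m n N" "E * mid' = 0\<^sub>m N n"
  "E * U = top' * \<alpha>" "V * E = \<beta> * bot"
  by (simp_all add: expand)

lemma dims_of_products:
  assumes "S \<subseteq> carrier_mat n n" and "Q \<in> products S"
  shows "dim_row Q = n" "dim_col Q = n"
  using products_carrier[OF assms] by auto

lemma bordered_in_products:
  assumes S: "S \<subseteq> carrier_mat n n" and Q: "Q \<in> products S"
  shows "U * Q * V \<in> products (insert E ((\<lambda>A. U * A * V) ` S))"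
  using Q
proof induction
  case (step A Q)
  have "dim_row A = n" "dim_col A = n" using step.hyps S by auto
  moreover note dims_of_products[OF S step.hyps(2)]
  ultimately have "U * (A * Q) * V = (U * A * V) * (U * Q * V)"
    using relations(1) by (simp add: mult_mat_assoc) (simp flip: mult_mat_assoc)
  with step show ?case by (auto intro: products.step)
qed (auto intro: products.base)

lemma products_cases:
  assumes S: "S \<subseteq> carrier_mat n n" and P: "P \<in> products (insert E ((\<lambda>A. U * A * V) ` S))"
  obtains "P = 0\<^sub>m N N" | "P = E"
  | Q L R where "Q \<in> products S" "P = L * (U * Q * V) * R"
      "L = 1\<^sub>m N \<or> L = E" "R = 1\<^sub>m N \<or> R = E"
proof -
  have "U \<in> carrier_mat N n" "V \<in> carrier_mat n N" "E \<in> carrier_mat N N"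
    by (auto intro: carrier_matI)
  from products_with_switch[OF this relations(1-3) S P] that show thesis by blast
qed

text \<open>
  Completeness is \<open>E (U Q V) E = top' (\<alpha> Q \<beta>) bot\<close>. For soundness one observes a product \<open>P\<close> through
  \<open>top P bot'\<close>: since \<open>top E = top\<close> and \<open>E bot' = bot'\<close>, the observation of \<open>U Q V\<close>
  is \<open>\<alpha> Q \<beta>\<close> whatever factors \<open>E\<close> surround it, whereas \<open>0\<close> and \<open>E\<close> are observed as \<open>0\<close>.
\<close>
lemma matrix_target_iff:
  assumes S: "S \<subseteq> carrier_mat n n" and \<Gamma>: "\<Gamma> \<in> carrier_mat p q" "\<Gamma> \<noteq> 0\<^sub>m p q"
  shows "top' * \<Gamma> * bot \<in> products (insert E ((\<lambda>A. U * A * V) ` S)) \<longleftrightarrow>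
    (\<exists>Q \<in> products S. \<alpha> * Q * \<beta> = \<Gamma>)"
proof
  note d [simp] = carrier_matD[OF \<Gamma>(1)]
  let ?P = "top' * \<Gamma> * bot"
  have obs: "top * ?P * bot' = \<Gamma>" by (simp add: mult_mat_assoc)
  assume "?P \<in> products (insert E ((\<lambda>A. U * A * V) ` S))"
  then show "\<exists>Q \<in> products S. \<alpha> * Q * \<beta> = \<Gamma>"
  proof (rule products_cases[OF S])
    fix Q L R
    assume Q: "Q \<in> products S" and P: "?P = L * (U * Q * V) * R"
      and L: "L = 1\<^sub>m N \<or> L = E" and R: "R = 1\<^sub>m N \<or> R = E"
    note [simp] = dims_of_products[OF S Q]
    have "dim_row L = N" "dim_col L = N" "dim_row R = N" "dim_col R = N" using L R by auto
    then have "top * (L * (U * Q * V) * R) * bot' = (top * L) * U * Q * (V * (R * bot'))"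
      by (simp add: mult_mat_assoc)
    then have "\<Gamma> = (top * L) * U * Q * (V * (R * bot'))" using obs P by simp
    also have "top * L = top" using L relations by auto
    also have "R * bot' = bot'" using R relations by auto
    finally show ?thesis using Q by (auto simp: relations)
  next
    assume "?P = 0\<^sub>m N N"
    with obs \<Gamma>(2) show ?thesis by simp
  next
    assume "?P = E"
    with obs \<Gamma>(2) show ?thesis by (simp add: relations)
  qed
next
  assume "\<exists>Q \<in> products S. \<alpha> * Q * \<beta> = \<Gamma>"
  then obtain Q where Q: "Q \<in> products S" "\<alpha> * Q * \<beta> = \<Gamma>" by blast
  note [simp] = dims_of_products[OF S Q(1)]
  have c: "insert E ((\<lambda>A. U * A * V) ` S) \<subseteq> carrier_mat N N"
    by (auto intro!: carrier_matI)
  have "E * (U * Q * V) * E \<in> products (insert E ((\<lambda>A. U * A * V) ` S))"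
    by (intro products_mult[OF c] bordered_in_products S Q products.base) auto
  also have "E * (U * Q * V) * E = (E * U) * Q * (V * E)" by (simp add: mult_mat_assoc)
  also have "\<dots> = top' * \<Gamma> * bot" by (simp add: relations Q(2)[symmetric] mult_mat_assoc)
  finally show "top' * \<Gamma> * bot \<in> products (insert E ((\<lambda>A. U * A * V) ` S))" .
qed

text \<open>
  Completeness is \<open>E (U Q V) = top' (\<alpha> Q) V\<close>. The observation is now \<open>top P mid'\<close>, and
  \<open>E mid' = 0\<close> rules out a factor \<open>E\<close> on the right.
\<close>
lemma matrix_target_exit_iff:
  assumes S: "S \<subseteq> carrier_mat n n" and \<Gamma>: "\<Gamma> \<in> carrier_mat p n" "\<Gamma> \<noteq> 0\<^sub>m p n"
  shows "top' * \<Gamma> * V \<in> products (insert E ((\<lambda>A. U * A * V) ` S)) \<longleftrightarrow>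
    (\<exists>Q \<in> products S. \<alpha> * Q = \<Gamma>)"
proof
  note d [simp] = carrier_matD[OF \<Gamma>(1)]
  let ?P = "top' * \<Gamma> * V"
  have obs: "top * ?P * mid' = \<Gamma>" by (simp add: mult_mat_assoc relations)
  assume "?P \<in> products (insert E ((\<lambda>A. U * A * V) ` S))"
  then show "\<exists>Q \<in> products S. \<alpha> * Q = \<Gamma>"
  proof (rule products_cases[OF S])
    fix Q L R
    assume Q: "Q \<in> products S" and P: "?P = L * (U * Q * V) * R"
      and L: "L = 1\<^sub>m N \<or> L = E" and R: "R = 1\<^sub>m N \<or> R = E"
    note [simp] = dims_of_products[OF S Q]
    have "dim_row L = N" "dim_col L = N" "dim_row R = N" "dim_col R = N" using L R by auto
    then have "top * (L * (U * Q * V) * R) * mid' = (top * L) * U * Q * (V * (R * mid'))"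
      by (simp add: mult_mat_assoc)
    then have eq: "\<Gamma> = (top * L) * U * Q * (V * (R * mid'))" using obs P by simp
    have "top * L = top" using L relations by auto
    moreover have "R = 1\<^sub>m N"
    proof (rule ccontr)
      assume "R \<noteq> 1\<^sub>m N"
      with R have "R * mid' = 0\<^sub>m N n" by (simp add: relations)
      with eq L \<Gamma>(2) show False by auto
    qed
    ultimately show ?thesis using eq Q by (auto simp: relations)
  next
    assume "?P = 0\<^sub>m N N"
    with obs \<Gamma>(2) show ?thesis by simp
  next
    assume "?P = E"
    with obs \<Gamma>(2) show ?thesis by (simp add: relations)
  qed
next
  assume "\<exists>Q \<in> products S. \<alpha> * Q = \<Gamma>"
  then obtain Q where Q: "Q \<in> products S" "\<alpha> * Q = \<Gamma>" by blast
  note [simp] = dims_of_products[OF S Q(1)]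
  have c: "insert E ((\<lambda>A. U * A * V) ` S) \<subseteq> carrier_mat N N"
    by (auto intro!: carrier_matI)
  have "E * (U * Q * V) \<in> products (insert E ((\<lambda>A. U * A * V) ` S))"
    by (intro products_mult[OF c] bordered_in_products S Q products.base) auto
  also have "E * (U * Q * V) = (E * U) * Q * V" by (simp add: mult_mat_assoc)
  also have "\<dots> = top' * \<Gamma> * V" by (simp add: relations Q(2)[symmetric] mult_mat_assoc)
  finally show "top' * \<Gamma> * V \<in> products (insert E ((\<lambda>A. U * A * V) ` S))" .
qed

text \<open>
  The start vector lives in the middle part, which \<open>E\<close> kills, so no factor \<open>E\<close> can come first; a last
  factor \<open>E\<close> clears the middle part and keeps the result \<open>\<xi> Q \<beta>\<close> in the lower one.
\<close>
lemma vector_target_iff: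
  assumes S: "S \<subseteq> carrier_mat n n" and \<xi>: "\<xi> \<in> carrier_mat m n"
    and \<Gamma>: "\<Gamma> \<in> carrier_mat m q" "\<Gamma> \<noteq> 0\<^sub>m m q"
  shows "(\<exists>P \<in> products (insert E ((\<lambda>A. U * A * V) ` S)). \<xi> * mid * P = \<Gamma> * bot) \<longleftrightarrow>
    (\<exists>Q \<in> products S. \<xi> * Q * \<beta> = \<Gamma>)"
proof
  note d [simp] = carrier_matD[OF \<Gamma>(1)] carrier_matD[OF \<xi>]
  assume "\<exists>P \<in> products (insert E ((\<lambda>A. U * A * V) ` S)). \<xi> * mid * P = \<Gamma> * bot"
  then obtain P where P: "P \<in> products (insert E ((\<lambda>A. U * A * V) ` S))"
    "\<xi> * mid * P = \<Gamma> * bot" by blast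
  have obs: "\<xi> * mid * P * bot' = \<Gamma>" unfolding P by (simp add: mult_mat_assoc)
  from P(1) show "\<exists>Q \<in> products S. \<xi> * Q * \<beta> = \<Gamma>"
  proof (rule products_cases[OF S])
    fix Q L R
    assume Q: "Q \<in> products S" and P: "P = L * (U * Q * V) * R"
      and L: "L = 1\<^sub>m N \<or> L = E" and R: "R = 1\<^sub>m N \<or> R = E"
    note [simp] = dims_of_products[OF S Q]
    have "dim_row L = N" "dim_col L = N" "dim_row R = N" "dim_col R = N" using L R by auto
    then have "\<xi> * mid * (L * (U * Q * V) * R) * bot' = \<xi> * ((mid * L) * (U * (Q * (V * (R * bot')))))"
      by (simp add: mult_mat_assoc)
    then have eq: "\<Gamma> = \<xi> * ((mid * L) * (U * (Q * (V * (R * bot')))))" using obs P by simp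
    have Rb: "R * bot' = bot'" using R relations by auto
    have "L = 1\<^sub>m N"
    proof (rule ccontr)
      assume "L \<noteq> 1\<^sub>m N"
      with L have "mid * L = 0\<^sub>m n N" by (simp add: relations)
      with eq Rb \<Gamma>(2) show False by simp
    qed
    moreover have "mid * (U * (Q * \<beta>)) = Q * \<beta>"
      using mult_mat_assoc[of mid U "Q * \<beta>"] by (simp add: relations)
    ultimately have "\<Gamma> = \<xi> * Q * \<beta>"
      using eq Rb by (simp add: relations mult_mat_assoc)
    with Q show ?thesis by auto
  next
    assume "P = 0\<^sub>m N N"
    with obs \<Gamma>(2) show ?thesis by simp
  next
    assume "P = E"
    with obs \<Gamma>(2) show ?thesis by (simp add: relations mult_mat_assoc)
  qed
next
  note d [simp] = carrier_matD[OF \<Gamma>(1)] carrier_matD[OF \<xi>]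
  assume "\<exists>Q \<in> products S. \<xi> * Q * \<beta> = \<Gamma>"
  then obtain Q where Q: "Q \<in> products S" "\<xi> * Q * \<beta> = \<Gamma>" by blast
  note [simp] = dims_of_products[OF S Q(1)]
  have c: "insert E ((\<lambda>A. U * A * V) ` S) \<subseteq> carrier_mat N N"
    by (auto intro!: carrier_matI)
  have "U * Q * V * E \<in> products (insert E ((\<lambda>A. U * A * V) ` S))"
    by (intro products_mult[OF c] bordered_in_products S Q products.base) auto
  moreover have "\<xi> * mid * (U * Q * V * E) = \<xi> * ((mid * U) * (Q * (V * E)))"
    by (simp add: mult_mat_assoc)
  then have "\<xi> * mid * (U * Q * V * E) = \<Gamma> * bot"
    by (simp add: relations Q(2)[symmetric] mult_mat_assoc)
  ultimately show "\<exists>P \<in> products (insert E ((\<lambda>A. U * A * V) ` S)). \<xi> * mid * P = \<Gamma> * bot"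
    by blast
qed

end


section \<open>Direct sums with one\<close>

text \<open>
  The direct sum \<open>1 \<oplus> A\<close>, and the row vector with a leading \<open>1\<close>: both are nonzero even for \<open>A = 0\<close>
  unless \<open>0 = 1\<close>, and products act on \<open>A\<close> alone.
\<close>
definition diag_one :: "'a :: {zero, one} mat \<Rightarrow> 'a mat" where
  "diag_one A = four_block_mat (1\<^sub>m 1) (0\<^sub>m 1 (dim_col A)) (0\<^sub>m (dim_row A) 1) A"

definition row_one :: "'a :: {zero, one} mat \<Rightarrow> 'a mat" where
  "row_one A = four_block_mat (1\<^sub>m 1) A (0\<^sub>m 0 1) (0\<^sub>m 0 (dim_col A))"

lemma diag_one_mult:
  fixes A B :: "'a :: {semiring_0, monoid_mult} mat"
  assumes "A \<in> carrier_mat m n" and "B \<in> carrier_mat n k"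
  shows "diag_one A * diag_one B = diag_one (A * B)"
  unfolding diag_one_def using assms by (subst mult_four_block_mat[of _ 1 1 _ n _ m _ _ 1 _ k]) auto

lemma row_one_mult:
  fixes A B :: "'a :: {semiring_0, monoid_mult} mat"
  assumes "A \<in> carrier_mat 1 n" and "B \<in> carrier_mat n k"
  shows "row_one A * diag_one B = row_one (A * B)"
  unfolding row_one_def diag_one_def using assms
  by (subst mult_four_block_mat[of _ 1 1 _ n _ 0 _ _ 1 _ k]) auto

lemma diag_one_inject:
  assumes "A \<in> carrier_mat m n" and "B \<in> carrier_mat m n"
  shows "diag_one A = diag_one B \<longleftrightarrow> A = B"
proof (intro iffI eq_matI)
  fix i j assume eq: "diag_one A = diag_one B" and ij: "i < dim_row B" "j < dim_col B"
  from eq have "diag_one A $$ (Suc i, Suc j) = diag_one B $$ (Suc i, Suc j)" by simp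
  with ij assms show "A $$ (i, j) = B $$ (i, j)" by (simp add: diag_one_def)
qed (use assms in auto)

lemma row_one_inject:
  assumes "A \<in> carrier_mat 1 n" and "B \<in> carrier_mat 1 n"
  shows "row_one A = row_one B \<longleftrightarrow> A = B"
proof (intro iffI eq_matI)
  fix i j assume eq: "row_one A = row_one B" and ij: "i < dim_row B" "j < dim_col B"
  from eq have "row_one A $$ (i, Suc j) = row_one B $$ (i, Suc j)" by simp
  with ij assms show "A $$ (i, j) = B $$ (i, j)" by (simp add: row_one_def)
qed (use assms in auto)

lemma one_entry_nonzero:
  fixes A :: "'a :: {zero, one} mat"
  assumes "(0 :: 'a) \<noteq> 1"
  shows "A \<in> carrier_mat m n \<Longrightarrow> diag_one A \<noteq> 0\<^sub>m (m + 1) (n + 1)"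
    and "A \<in> carrier_mat 1 n \<Longrightarrow> row_one A \<noteq> 0\<^sub>m 1 (n + 1)"
proof -
  assume "A \<in> carrier_mat m n"
  then have "diag_one A $$ (0, 0) \<noteq> 0\<^sub>m (m + 1) (n + 1) $$ (0, 0)"
    using assms by (simp add: diag_one_def)
  then show "diag_one A \<noteq> 0\<^sub>m (m + 1) (n + 1)" by metis
next
  assume "A \<in> carrier_mat 1 n"
  then have "row_one A $$ (0, 0) \<noteq> 0\<^sub>m 1 (n + 1) $$ (0, 0)"
    using assms by (simp add: row_one_def)
  then show "row_one A \<noteq> 0\<^sub>m 1 (n + 1)" by metis
qed

lemma products_diag_one:
  fixes S :: "'a :: {semiring_0, monoid_mult} mat set"
  assumes S: "S \<subseteq> carrier_mat n n"
  shows "products (diag_one ` S) = diag_one ` products S"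
proof (intro equalityI subsetI)
  fix P assume "P \<in> products (diag_one ` S)"
  then show "P \<in> diag_one ` products S"
  proof induction
    case (step A P)
    then obtain B Q where *: "B \<in> S" "A = diag_one B" "Q \<in> products S" "P = diag_one Q" by auto
    then have "A * P = diag_one (B * Q)"
      using products_carrier[OF S *(3)] S by (auto simp: diag_one_mult)
    with * show ?case by (auto intro: products.step)
  qed (auto intro: products.base)
next
  fix P assume "P \<in> diag_one ` products S"
  then obtain Q where Q: "Q \<in> products S" "P = diag_one Q" by auto
  from Q(1) have "diag_one Q \<in> products (diag_one ` S)"
  proof induction
    case (step A Q)
    then have "diag_one (A * Q) = diag_one A * diag_one Q"
      using products_carrier[OF S] S by (auto simp: diag_one_mult[of _ n n _ n])
    with step show ?case by (auto intro: products.step)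
  qed (auto intro: products.base)
  with Q show "P \<in> products (diag_one ` S)" by simp
qed


section \<open>Simulating several generators by two\<close>

definition select_mat ::
  "nat \<Rightarrow> nat \<Rightarrow> 'a :: {semiring_0, monoid_mult} mat list \<Rightarrow> 'a mat" where
  "select_mat r n As = mat (r * n) (r * n)
    (\<lambda>(i, j). if j < n then (As ! (i div n)) $$ (i mod n, j) else 0)"

text \<open>
  Coordinate \<open>i\<close> belongs to block \<open>i div n\<close>; it lies in the last block exactly if \<open>i + n \<ge> r * n\<close>.
\<close>
definition advance_mat ::
  "nat \<Rightarrow> nat \<Rightarrow> 'a :: {semiring_0, monoid_mult} mat \<Rightarrow> 'a mat" where
  "advance_mat r n B = mat (r * n) (r * n)
    (\<lambda>(i, j). if i + n < r * n then (if j = i + n then 1 else 0)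
      else if j < n then B $$ (i mod n, j) else 0)"

text \<open>
  A row vector supported on block \<open>s\<close> is \<open>v * blk s\<close>, and \<open>blk s * P\<close> is the \<open>s\<close>-th block row of \<open>P\<close>. In
  each block row of a product of \<open>X\<close> and \<open>Y\<close> at most one block is nonzero, because both letters map
  every block to a single block.
\<close>
locale block_automaton =
  fixes r n :: nat and As :: "'a :: {semiring_0, monoid_mult} mat list" and B :: "'a mat"
    and X Y :: "'a mat" and blk :: "nat \<Rightarrow> 'a mat"
  assumes r: "r \<ge> 1" and As: "As \<in> generators r n" and B: "B \<in> carrier_mat n n"
  defines "X \<equiv> select_mat r n As" and "Y \<equiv> advance_mat r n B"
    and "blk \<equiv> \<lambda>s. unit_rows (r * n) (s * n) n"
begin

lemma block_le: "s < r \<Longrightarrow> s * n + n \<le> r * n"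
proof -
  assume "s < r"
  then have "(s + 1) * n \<le> r * n" by (intro mult_right_mono) auto
  then show ?thesis by simp
qed

lemma As_nth: "s < r \<Longrightarrow> As ! s \<in> set As" "s < r \<Longrightarrow> As ! s \<in> carrier_mat n n"
  "set As \<subseteq> carrier_mat n n"
  using As by (auto simp: generators_def)

lemma dims [simp]:
  "dim_row X = r * n" "dim_col X = r * n" "dim_row Y = r * n" "dim_col Y = r * n"
  "dim_row (blk s) = n" "dim_col (blk s) = r * n" "dim_row B = n" "dim_col B = n"
  "X \<in> carrier_mat (r * n) (r * n)" "Y \<in> carrier_mat (r * n) (r * n)"
  "blk s \<in> carrier_mat n (r * n)"
  "s < r \<Longrightarrow> dim_row (As ! s) = n" "s < r \<Longrightarrow> dim_col (As ! s) = n"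
  using B As_nth(2)[of s] by (auto simp: X_def Y_def blk_def select_mat_def advance_mat_def)

lemma blk_mult: "s < r \<Longrightarrow> dim_row W = r * n \<Longrightarrow>
    blk s * W = mat n (dim_col W) (\<lambda>(i, j). W $$ (s * n + i, j))"
  unfolding blk_def by (rule unit_rows_mult) (simp_all add: block_le)

lemma mult_blk_0: "dim_col W = n \<Longrightarrow>
    W * blk 0 = mat (dim_row W) (r * n) (\<lambda>(i, j). if j < n then W $$ (i, j) else 0)"
  unfolding blk_def by (subst mult_unit_rows) auto

lemma blk_X: "s < r \<Longrightarrow> blk s * X = As ! s * blk 0"
proof (rule eq_matI, goal_cases)
  case (1 i j)
  then have "i < n" "j < r * n" "s * n + i < r * n" using block_le[of s] by simp_all
  then show ?case using 1(1) by (simp add: blk_mult mult_blk_0 X_def select_mat_def)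
qed simp_all

lemma blk_Y:
  assumes "s + 1 < r"
  shows "blk s * Y = blk (s + 1)"
proof (rule eq_matI, goal_cases)
  case (1 i j)
  then have *: "i < n" "j < r * n" by simp_all
  moreover have "s * n + i + n < r * n" using block_le[OF assms] * by simp
  moreover from this have "s * n + i < r * n" by simp
  moreover have "s < r" using assms by simp
  moreover have "blk (s + 1) $$ (i, j) = (if j = s * n + i + n then 1 else 0)"
    using * by (simp add: blk_def unit_rows_def algebra_simps)
  ultimately show ?case by (simp add: blk_mult Y_def advance_mat_def)
qed simp_all

lemma blk_Y_last: "blk (r - 1) * Y = B * blk 0"
proof (rule eq_matI, goal_cases)
  case (1 i j)
  then have *: "i < n" "j < r * n" by simp_all
  have s: "r - 1 < r" and "r = r - 1 + 1" using r by simp_all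
  then have "r * n = (r - 1) * n + n" by (metis add_mult_distrib mult_1)
  with * have "(r - 1) * n + i < r * n" "\<not> (r - 1) * n + i + n < r * n" by simp_all
  with * s show ?case by (simp add: blk_mult mult_blk_0 Y_def advance_mat_def)
qed simp_all

text \<open>
  The alternative \<open>Q = 1\<^sub>m n\<close> belongs to the words that have not applied any matrix: they consist of
  letters \<open>Y\<close> and have only moved to a later state.
\<close>
lemma track:
  assumes "P \<in> products {X, Y}" and "s < r"
  obtains s' Q where "s' < r" "Q \<in> products (insert B (set As)) \<or> Q = 1\<^sub>m n \<and> s < s'"
    "blk s * P = Q * blk s'"
proof -
  have S: "insert B (set As) \<subseteq> carrier_mat n n" using As_nth(3) B by auto
  have letter: "\<exists>s' < r. \<exists>Q. blk s * G = Q * blk s' \<and> Q \<in> carrier_mat n n \<and>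
      (Q \<in> insert B (set As) \<or> Q = 1\<^sub>m n \<and> s < s')" if "G \<in> {X, Y}" "s < r" for G s
  proof -
    have "s + 1 < r \<or> s = r - 1" using that(2) by linarith
    with that(1) consider "G = X" | "G = Y" "s + 1 < r" | "G = Y" "s = r - 1" by blast
    then show ?thesis
    proof cases
      case 1
      with blk_X[OF that(2)] r As_nth(1,2)[OF that(2)] show ?thesis
        by (intro exI[of _ 0] conjI exI[of _ "As ! s"]) auto
    next
      case 2
      with blk_Y[of s] show ?thesis
        by (intro exI[of _ "s + 1"] conjI exI[of _ "1\<^sub>m n"]) auto
    next
      case 3
      with blk_Y_last r B show ?thesis
        by (intro exI[of _ 0] conjI exI[of _ B]) auto
    qed
  qed
  have "\<exists>s' < r. \<exists>Q. blk s * P = Q * blk s' \<and>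
      (Q \<in> products (insert B (set As)) \<or> Q = 1\<^sub>m n \<and> s < s')"
    using assms
  proof (induction arbitrary: s)
    case (base G)
    from letter[OF base] show ?case by (blast intro: products.base)
  next
    case (step G P)
    from letter[OF step.hyps(1) step.prems] obtain s1 A where A: "s1 < r" "blk s * G = A * blk s1"
      "A \<in> carrier_mat n n" "A \<in> insert B (set As) \<or> A = 1\<^sub>m n \<and> s < s1" by blast
    from step.IH[OF A(1)] obtain s' Q where Q: "s' < r" "blk s1 * P = Q * blk s'"
      "Q \<in> products (insert B (set As)) \<or> Q = 1\<^sub>m n \<and> s1 < s'" by blast
    have "dim_row G = r * n" "dim_col G = r * n" "dim_row P = r * n"
      using step.hyps products_carrier[of "{X, Y}" "r * n" P] by auto
    moreover have Qd: "dim_row Q = n" "dim_col Q = n" using Q(3) products_carrier[OF S] by auto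
    moreover have "dim_col A = n" using A(3) by simp
    moreover have "blk s * (G * P) = (blk s * G) * P" using calculation by (simp add: mult_mat_assoc)
    ultimately have "blk s * (G * P) = (A * Q) * blk s'"
      using Q(2) unfolding A(2) by (simp add: mult_mat_assoc)
    moreover have "A * Q \<in> products (insert B (set As)) \<or> A * Q = 1\<^sub>m n \<and> s < s'"
    proof -
      consider "Q \<in> products (insert B (set As))" "A \<in> insert B (set As)"
        | "Q = 1\<^sub>m n" "A \<in> insert B (set As)" | "A = 1\<^sub>m n" "s < s1" using A(4) Q(3) by blast
      then show ?thesis
      proof cases
        case 1
        then show ?thesis using products.step[OF 1(2,1)] by simp
      next
        case 2
        with A(3) show ?thesis by (auto intro: products.base)
      next
        case 3
        with Q(3) Qd show ?thesis by auto
      qed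
    qed
    ultimately show ?case using Q(1) by blast
  qed
  with that show ?thesis by blast
qed

text \<open>
  Started in state \<open>s\<close>, the word \<open>Y\<^sup>k X\<close> acts as \<open>A\<^sub>s\<^sub>+\<^sub>k\<close>, as long as there is a state \<open>s + k\<close>.
\<close>
definition run :: "nat \<Rightarrow> 'a mat" where
  "run k = (((*) Y) ^^ k) X"

lemma run_in_products: "run k \<in> products {X, Y}"
  by (induction k) (auto simp: run_def intro: products.intros)

lemma run_dims [simp]: "dim_row (run k) = r * n" "dim_col (run k) = r * n"
  using products_carrier[OF _ run_in_products, of "r * n" k] by auto

lemma run_Suc: "run (Suc k) = Y * run k"
  by (simp add: run_def)

lemma blk_run: "s + k < r \<Longrightarrow> blk s * run k = As ! (s + k) * blk 0"
proof (induction k arbitrary: s)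
  case 0
  then show ?case by (simp add: run_def blk_X)
next
  case (Suc k)
  have "blk s * run (Suc k) = (blk s * Y) * run k" by (simp add: run_Suc mult_mat_assoc)
  with Suc show ?case by (simp add: blk_Y)
qed

text \<open>
  With \<open>B = 0\<close> a run that starts too late falls off the last state and is annihilated there.
\<close>
lemma blk_run_zero:
  assumes "B = 0\<^sub>m n n" and "s < r" and "s + k \<ge> r"
  shows "blk s * run k = 0\<^sub>m n (r * n)"
  using assms(2,3)
proof (induction k arbitrary: s)
  case (Suc k)
  have eq: "blk s * run (Suc k) = (blk s * Y) * run k" by (simp add: run_Suc mult_mat_assoc)
  show ?case
  proof (cases "s + 1 < r")
    case True
    with Suc eq show ?thesis by (simp add: blk_Y)
  next
    case False
    with Suc have s: "s = r - 1" by simp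
    have "B * blk 0 = 0\<^sub>m n (r * n)" using assms(1) by simp
    with s have "blk s * Y = 0\<^sub>m n (r * n)" by (simp only: blk_Y_last)
    with eq show ?thesis by simp
  qed
qed simp

lemma simulate:
  assumes "Q \<in> products (set As)"
  obtains P where "P \<in> products {X, Y}" "blk 0 * P = Q * blk 0"
proof -
  have c: "{X, Y} \<subseteq> carrier_mat (r * n) (r * n)" by simp
  from assms have "\<exists>P \<in> products {X, Y}. blk 0 * P = Q * blk 0"
  proof induction
    case (base A)
    then obtain s where "s < r" "A = As ! s" using As by (auto simp: generators_def in_set_conv_nth)
    with blk_run[of 0 s] run_in_products[of s] show ?case by auto
  next
    case (step A Q)
    then obtain s where s: "s < r" "A = As ! s" using As by (auto simp: generators_def in_set_conv_nth)
    from step obtain P where P: "P \<in> products {X, Y}" "blk 0 * P = Q * blk 0" by auto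
    have [simp]: "dim_row P = r * n" "dim_col P = r * n" "dim_row Q = n" "dim_col Q = n"
      using products_carrier[OF c P(1)] products_carrier[OF As_nth(3) step.hyps(2)] by auto
    have "blk 0 * (run s * P) = (blk 0 * run s) * P" by (simp add: mult_mat_assoc)
    also have "\<dots> = (A * Q) * blk 0" using s P(2) blk_run[of 0 s] by (simp add: mult_mat_assoc)
    finally show ?case using products_mult[OF c run_in_products P(1)] by blast
  qed
  with that show ?thesis by blast
qed

definition blk' :: "nat \<Rightarrow> 'a mat" where
  "blk' s = unit_cols (r * n) (s * n) n"

lemma blk'_dims [simp]: "dim_row (blk' s) = r * n" "dim_col (blk' s) = n"
  by (simp_all add: blk'_def)

lemma blk_blk':
  assumes "s < r" and "t < r"
  shows "blk s * blk' t = (if s = t then 1\<^sub>m n else 0\<^sub>m n n)"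
proof (cases s t rule: linorder_cases)
  case less
  then have "(s + 1) * n \<le> t * n" by (intro mult_right_mono) auto
  with less block_le[OF assms(1)] show ?thesis
    by (simp add: blk_def blk'_def unit_rows_mult_unit_cols)
next
  case equal
  with block_le[OF assms(1)] show ?thesis by (simp add: blk_def blk'_def unit_rows_mult_unit_cols)
next
  case greater
  then have "(t + 1) * n \<le> s * n" by (intro mult_right_mono) auto
  with greater block_le[OF assms(1)] show ?thesis
    by (simp add: blk_def blk'_def unit_rows_mult_unit_cols)
qed

lemma block_row_eq_iff:
  assumes "C \<in> carrier_mat m n" and "D \<in> carrier_mat m n" and "s < r" and "t < r"
  shows "C * blk s = D * blk t \<longleftrightarrow> C = D \<and> (s = t \<or> C = 0\<^sub>m m n)"
proof
  note [simp] = carrier_matD[OF assms(1)] carrier_matD[OF assms(2)]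
  assume *: "C * blk s = D * blk t"
  have 1: "C * (blk s * blk' s) = D * (blk t * blk' s)"
    using arg_cong[OF *, of "\<lambda>W. W * blk' s"] by (simp add: mult_mat_assoc)
  have 2: "C * (blk s * blk' t) = D * (blk t * blk' t)"
    using arg_cong[OF *, of "\<lambda>W. W * blk' t"] by (simp add: mult_mat_assoc)
  show "C = D \<and> (s = t \<or> C = 0\<^sub>m m n)"
    using 1 2 assms(3,4) by (cases "s = t") (simp_all add: blk_blk')
next
  assume "C = D \<and> (s = t \<or> C = 0\<^sub>m m n)"
  with assms show "C * blk s = D * blk t" by auto
qed

lemma product_dims:
  assumes "P \<in> products {X, Y}"
  shows "dim_row P = r * n" "dim_col P = r * n"
  using products_carrier[OF _ assms, of "r * n"] by auto

text \<open>
  A word that has applied nothing ends in a state other than \<open>0\<close>, where it can meet the target only if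
  both the start vector and the target are zero. Then \<open>B\<close> itself leads from one to the other.
\<close>
lemma vector_reach_iff:
  assumes B_in: "B \<in> set As" and \<alpha>: "\<alpha> \<in> carrier_mat m n" and \<eta>: "\<eta> \<in> carrier_mat m n"
  shows "(\<exists>P \<in> products {X, Y}. \<alpha> * blk 0 * P = \<eta> * blk 0) \<longleftrightarrow>
    (\<exists>Q \<in> products (set As). \<alpha> * Q = \<eta>)"
proof
  note [simp] = carrier_matD[OF \<alpha>] carrier_matD[OF \<eta>]
  assume "\<exists>P \<in> products {X, Y}. \<alpha> * blk 0 * P = \<eta> * blk 0"
  then obtain P where P: "P \<in> products {X, Y}" "\<alpha> * blk 0 * P = \<eta> * blk 0" by blast
  have r0: "0 < r" using r by simp
  obtain s Q where s: "s < r" "Q \<in> products (insert B (set As)) \<or> Q = 1\<^sub>m n \<and> 0 < s"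
    "blk 0 * P = Q * blk s"
    using track[OF P(1) r0] by metis
  have S: "insert B (set As) = set As" using B_in by auto
  have Q: "Q \<in> carrier_mat n n" using s(2) products_carrier[OF As_nth(3)] unfolding S by auto
  note [simp] = carrier_matD[OF Q]
  have "(\<alpha> * Q) * blk s = \<alpha> * (blk 0 * P)" unfolding s(3) by (simp add: mult_mat_assoc)
  also have "\<dots> = \<eta> * blk 0" using P(2) product_dims[OF P(1)] by (simp add: mult_mat_assoc)
  finally have eq: "\<alpha> * Q = \<eta>" "s = 0 \<or> \<eta> = 0\<^sub>m m n"
    using block_row_eq_iff[of "\<alpha> * Q" m \<eta> s 0] s(1) r0 \<alpha> \<eta> Q by auto
  show "\<exists>Q \<in> products (set As). \<alpha> * Q = \<eta>"
  proof (cases "Q \<in> products (set As)")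
    case True
    with eq show ?thesis by blast
  next
    case False
    with s(2) eq S have "\<alpha> = \<eta>" "\<eta> = 0\<^sub>m m n" by auto
    then have "\<alpha> * B = \<eta>" by simp
    with B_in show ?thesis by (auto intro: products.base)
  qed
next
  note [simp] = carrier_matD[OF \<alpha>] carrier_matD[OF \<eta>]
  assume "\<exists>Q \<in> products (set As). \<alpha> * Q = \<eta>"
  then obtain Q where Q: "Q \<in> products (set As)" "\<alpha> * Q = \<eta>" by blast
  note [simp] = carrier_matD[OF products_carrier[OF As_nth(3) Q(1)]]
  obtain P where P: "P \<in> products {X, Y}" "blk 0 * P = Q * blk 0" using simulate[OF Q(1)] .
  have "\<alpha> * blk 0 * P = \<alpha> * (blk 0 * P)" using product_dims[OF P(1)] by (simp add: mult_mat_assoc)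
  also have "\<dots> = \<eta> * blk 0" unfolding P(2) Q(2)[symmetric] by (simp add: mult_mat_assoc)
  finally show "\<exists>P \<in> products {X, Y}. \<alpha> * blk 0 * P = \<eta> * blk 0" using P(1) by blast
qed

text \<open>
  A word that ends in a state other than \<open>0\<close> may have applied nothing. There the final vector \<open>\<beta>'\<close>
  applies \<open>A\<^sub>0\<close> once more, so that every word accounts for a nonempty product.
\<close>
lemma scalar_reach_iff:
  assumes B_in: "B \<in> set As" and \<alpha>: "\<alpha> \<in> carrier_mat m n" and \<beta>: "\<beta> \<in> carrier_mat n k"
    and \<beta>': "\<beta>' \<in> carrier_mat (r * n) k" "blk 0 * \<beta>' = \<beta>"
      "\<And>s. 0 < s \<Longrightarrow> s < r \<Longrightarrow> blk s * \<beta>' = As ! 0 * \<beta>"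
  shows "(\<exists>P \<in> products {X, Y}. \<alpha> * blk 0 * P * \<beta>' = \<Gamma>) \<longleftrightarrow>
    (\<exists>Q \<in> products (set As). \<alpha> * Q * \<beta> = \<Gamma>)"
proof
  note [simp] = carrier_matD[OF \<alpha>] carrier_matD[OF \<beta>] carrier_matD[OF \<beta>'(1)]
  assume "\<exists>P \<in> products {X, Y}. \<alpha> * blk 0 * P * \<beta>' = \<Gamma>"
  then obtain P where P: "P \<in> products {X, Y}" "\<alpha> * blk 0 * P * \<beta>' = \<Gamma>" by blast
  have r0: "0 < r" using r by simp
  obtain s Q where s: "s < r" "Q \<in> products (insert B (set As)) \<or> Q = 1\<^sub>m n \<and> 0 < s"
    "blk 0 * P = Q * blk s"
    using track[OF P(1) r0] by metis
  have S: "insert B (set As) = set As" using B_in by auto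
  have Q: "Q \<in> carrier_mat n n" using s(2) products_carrier[OF As_nth(3)] unfolding S by auto
  note [simp] = carrier_matD[OF Q]
  have "\<Gamma> = \<alpha> * (blk 0 * P * \<beta>')"
    unfolding P(2)[symmetric] using product_dims[OF P(1)] by (simp add: mult_mat_assoc)
  then have eq: "\<Gamma> = \<alpha> * (Q * (blk s * \<beta>'))" unfolding s(3) by (simp add: mult_mat_assoc)
  consider "s = 0" "Q \<in> products (set As)" | "s > 0" "Q \<in> products (set As)" | "s > 0" "Q = 1\<^sub>m n"
    using s(2) S by auto
  then show "\<exists>Q \<in> products (set As). \<alpha> * Q * \<beta> = \<Gamma>"
  proof cases
    case 1
    with eq \<beta>'(2) have "\<alpha> * Q * \<beta> = \<Gamma>" by (simp add: mult_mat_assoc)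
    with 1 show ?thesis by blast
  next
    case 2
    with eq \<beta>'(3)[of s] s(1) r0 have "\<alpha> * (Q * As ! 0) * \<beta> = \<Gamma>" by (simp add: mult_mat_assoc)
    with products_mult[OF As_nth(3) 2(2) products.base[OF As_nth(1)[OF r0]]] show ?thesis by blast
  next
    case 3
    with eq \<beta>'(3)[of s] s(1) r0 have "\<alpha> * As ! 0 * \<beta> = \<Gamma>" by (simp add: mult_mat_assoc)
    with products.base[OF As_nth(1)[OF r0]] show ?thesis by blast
  qed
next
  note [simp] = carrier_matD[OF \<alpha>] carrier_matD[OF \<beta>] carrier_matD[OF \<beta>'(1)]
  assume "\<exists>Q \<in> products (set As). \<alpha> * Q * \<beta> = \<Gamma>"
  then obtain Q where Q: "Q \<in> products (set As)" "\<alpha> * Q * \<beta> = \<Gamma>" by blast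
  note [simp] = carrier_matD[OF products_carrier[OF As_nth(3) Q(1)]]
  obtain P where P: "P \<in> products {X, Y}" "blk 0 * P = Q * blk 0" using simulate[OF Q(1)] .
  have "\<alpha> * blk 0 * P * \<beta>' = \<alpha> * (blk 0 * P * \<beta>')"
    using product_dims[OF P(1)] by (simp add: mult_mat_assoc)
  also have "\<dots> = \<alpha> * (Q * (blk 0 * \<beta>'))" unfolding P(2) by (simp add: mult_mat_assoc)
  also have "\<dots> = \<Gamma>" using Q(2) unfolding \<beta>'(2) by (simp add: mult_mat_assoc)
  finally show "\<exists>P \<in> products {X, Y}. \<alpha> * blk 0 * P * \<beta>' = \<Gamma>" using P(1) by blast
qed

lemma eq_mat_iff_blk:
  assumes "W \<in> carrier_mat (r * n) m" and "W' \<in> carrier_mat (r * n) m"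
  shows "W = W' \<longleftrightarrow> (\<forall>s < r. blk s * W = blk s * W')"
  unfolding blk_def by (rule eq_mat_iff_unit_rows[OF assms])

text \<open>
  From every state \<open>X\<close> leads to state \<open>0\<close>, so a word that kills block row \<open>0\<close> kills all
  block rows once it is preceded by \<open>X\<close>. Conversely, block row \<open>0\<close> of a zero product shows a
  matrix \<open>0\<close> that has been applied; it is a product of generators because it differs from \<open>1\<^sub>m n\<close>.
\<close>
lemma mortality_iff:
  assumes B_in: "B \<in> set As" and n: "n \<ge> 1" and nontrivial: "(0 :: 'a) \<noteq> 1"
  shows "0\<^sub>m (r * n) (r * n) \<in> products {X, Y} \<longleftrightarrow> 0\<^sub>m n n \<in> products (set As)"
proof
  assume P: "0\<^sub>m (r * n) (r * n) \<in> products {X, Y}"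
  have r0: "0 < r" using r by simp
  obtain s Q where s: "s < r" "Q \<in> products (insert B (set As)) \<or> Q = 1\<^sub>m n \<and> 0 < s"
    "blk 0 * 0\<^sub>m (r * n) (r * n) = Q * blk s"
    using track[OF P(1) r0] by metis
  have S: "insert B (set As) = set As" using B_in by auto
  have Q: "Q \<in> carrier_mat n n" using s(2) products_carrier[OF As_nth(3)] unfolding S by auto
  have "Q * blk s = 0\<^sub>m n n * blk 0" using s(3) by simp
  then have "Q = 0\<^sub>m n n" using block_row_eq_iff[OF Q _ s(1) r0, of "0\<^sub>m n n"] by simp
  moreover have "1\<^sub>m n $$ (0, 0) \<noteq> (0\<^sub>m n n $$ (0, 0) :: 'a)" using n nontrivial by simp
  ultimately show "0\<^sub>m n n \<in> products (set As)" using s(2) S by auto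
next
  assume Z: "0\<^sub>m n n \<in> products (set As)"
  obtain P where P: "P \<in> products {X, Y}" "blk 0 * P = 0\<^sub>m n n * blk 0" using simulate[OF Z] .
  note [simp] = product_dims[OF P(1)]
  have "X * P = 0\<^sub>m (r * n) (r * n)"
  proof (subst eq_mat_iff_blk[of _ "r * n"], goal_cases)
    case 3
    show ?case
    proof (intro allI impI)
    fix s assume s: "s < r"
    have "blk s * (X * P) = (blk s * X) * P" by (simp add: mult_mat_assoc)
    also have "\<dots> = As ! s * (blk 0 * P)" using s by (simp add: blk_X mult_mat_assoc)
    finally show "blk s * (X * P) = blk s * 0\<^sub>m (r * n) (r * n)" using s P(2) by simp
    qed
  qed (auto intro: carrier_matI)
  moreover have "X * P \<in> products {X, Y}" using P(1) by (auto intro: products.step)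
  ultimately show "0\<^sub>m (r * n) (r * n) \<in> products {X, Y}" by simp
qed

lemma blk_corner: "s < r \<Longrightarrow> M \<in> carrier_mat n n \<Longrightarrow>
    blk s * (blk' 0 * M * blk 0) = (if s = 0 then M * blk 0 else 0\<^sub>m n (r * n))"
proof -
  assume s: "s < r" and M: "M \<in> carrier_mat n n"
  have "blk s * (blk' 0 * M * blk 0) = (blk s * blk' 0) * (M * blk 0)"
    using M by (simp add: mult_mat_assoc)
  then show ?thesis using s M by (simp add: blk_blk')
qed

text \<open>
  The matrix \<open>blk' 0 * M * blk 0\<close> has \<open>M\<close> as its upper left block and zeros elsewhere. Block row \<open>0\<close>
  alone forces \<open>M\<close> to be a product of generators: the factor \<open>B = 0\<close> could only produce \<open>0\<close>.
\<close>
lemma corner_sound: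
  assumes B_zero: "B = 0\<^sub>m n n" and M: "M \<in> carrier_mat n n" "M \<noteq> 0\<^sub>m n n"
    and T: "blk' 0 * M * blk 0 \<in> products {X, Y}"
  shows "M \<in> products (set As)"
proof -
  have r0: "0 < r" using r by simp
  obtain s Q where s: "s < r" "Q \<in> products (insert B (set As)) \<or> Q = 1\<^sub>m n \<and> 0 < s"
    "blk 0 * (blk' 0 * M * blk 0) = Q * blk s"
    using track[OF T r0] by metis
  have S: "insert B (set As) \<subseteq> carrier_mat n n" using As_nth(3) B by auto
  have Q: "Q \<in> carrier_mat n n" using s(2) products_carrier[OF S] by auto
  have "Q * blk s = M * blk 0" using s(3) blk_corner[OF r0 M(1)] by simp
  then have "Q = M" "s = 0" using block_row_eq_iff[OF Q M(1) s(1) r0] M(2) by auto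
  then have Mp: "M \<in> products (insert B (set As))" using s(2) by auto
  have "P \<in> products (set As) \<or> P = 0\<^sub>m n n" if "P \<in> products (insert B (set As))" for P
    using that
  proof induction
    case (base A)
    then show ?case using B_zero by (auto intro: products.base)
  next
    case (step A P)
    then have "A \<in> carrier_mat n n" "P \<in> carrier_mat n n" using S products_carrier[OF S] by auto
    with step B_zero show ?case by (auto intro: products.step)
  qed
  with Mp M(2) show ?thesis by blast
qed

text \<open>
  Every state other than \<open>0\<close> is too late for \<open>run (r - 1)\<close>, so this word leaves only block row \<open>0\<close>,
  where it acts as the last generator.
\<close>
lemma corner_complete:
  assumes B_zero: "B = 0\<^sub>m n n"
    and Q: "Q = As ! (r - 1) \<or> (\<exists>Q' \<in> products (set As). Q = As ! (r - 1) * Q')"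
  shows "blk' 0 * Q * blk 0 \<in> products {X, Y}"
proof -
  have c: "{X, Y} \<subseteq> carrier_mat (r * n) (r * n)" by simp
  have r0: "0 < r" "r - 1 < r" using r by simp_all
  have first: "blk 0 * run (r - 1) = As ! (r - 1) * blk 0" using blk_run[of 0 "r - 1"] r0 by simp
  have other: "blk s * run (r - 1) = 0\<^sub>m n (r * n)" if "0 < s" "s < r" for s
    using blk_run_zero[OF B_zero that(2)] that by simp
  have corner: "P = blk' 0 * Q * blk 0"
    if "dim_row P = r * n" "dim_col P = r * n" "Q \<in> carrier_mat n n" "blk 0 * P = Q * blk 0"
      "\<And>s. 0 < s \<Longrightarrow> s < r \<Longrightarrow> blk s * P = 0\<^sub>m n (r * n)" for P
  proof -
    have "P \<in> carrier_mat (r * n) (r * n)" "blk' 0 * Q * blk 0 \<in> carrier_mat (r * n) (r * n)"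
      using that(1,2) by (auto intro: carrier_matI)
    moreover have "blk s * P = blk s * (blk' 0 * Q * blk 0)" if "s < r" for s
      using \<open>blk 0 * P = Q * blk 0\<close> \<open>\<And>s. 0 < s \<Longrightarrow> s < r \<Longrightarrow> blk s * P = 0\<^sub>m n (r * n)\<close> that
        blk_corner[OF that \<open>Q \<in> carrier_mat n n\<close>] by (cases "s = 0") auto
    ultimately show ?thesis using eq_mat_iff_blk by blast
  qed
  from Q show ?thesis
  proof
    assume "Q = As ! (r - 1)"
    with corner[of "run (r - 1)"] first other As_nth(2)[OF r0(2)] run_in_products[of "r - 1"]
    show ?thesis by simp
  next
    assume "\<exists>Q' \<in> products (set As). Q = As ! (r - 1) * Q'"
    then obtain Q' where Q': "Q' \<in> products (set As)" "Q = As ! (r - 1) * Q'" by blast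
    note [simp] = carrier_matD[OF products_carrier[OF As_nth(3) Q'(1)]]
    obtain P where P: "P \<in> products {X, Y}" "blk 0 * P = Q' * blk 0" using simulate[OF Q'(1)] .
    note [simp] = product_dims[OF P(1)]
    have "run (r - 1) * P = blk' 0 * Q * blk 0"
    proof (rule corner)
      show "Q \<in> carrier_mat n n" using Q' r0 by (auto intro: carrier_matI)
      have "blk 0 * (run (r - 1) * P) = (blk 0 * run (r - 1)) * P" by (simp add: mult_mat_assoc)
      also have "\<dots> = As ! (r - 1) * (blk 0 * P)" unfolding first using r0 by (simp add: mult_mat_assoc)
      also have "\<dots> = Q * blk 0" unfolding P(2) Q'(2) using r0 by (simp add: mult_mat_assoc)
      finally show "blk 0 * (run (r - 1) * P) = Q * blk 0" .
      show "blk s * (run (r - 1) * P) = 0\<^sub>m n (r * n)" if "0 < s" "s < r" for s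
        using other[OF that] by (simp flip: mult_mat_assoc)
    qed simp_all
    moreover have "run (r - 1) * P \<in> products {X, Y}"
      by (rule products_mult[OF c run_in_products P(1)])
    ultimately show ?thesis by simp
  qed
qed

end


section \<open>Computable quantities and decidable questions\<close>

text \<open>
  The algorithm makes no query, so it can prepare the arguments of queries to any problem.
\<close>
definition computable ::
  "'a :: {semiring_0, monoid_mult} representation \<Rightarrow> ('i, 'a) problem \<Rightarrow> ('i \<Rightarrow> 'a) \<Rightarrow> bool" where
  "computable \<nu> P g \<longleftrightarrow> (\<exists>f. \<forall>orc. semiring_oracles \<nu> orc \<longrightarrow>
    (\<forall>x \<in> instances P. \<forall>cs. represents \<nu> cs (entries P x) \<longrightarrow>
      (\<exists>y. computes orc f cs y {} \<and> \<nu> y = Some (g x))))"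

text \<open>
  The condition of \<open>reduces_within\<close>, with an arbitrary predicate in place of solvability. In this form it
  is closed under Boolean operations, so that several queries can be combined.
\<close>
definition decidable_within ::
  "('i \<Rightarrow> 'j \<Rightarrow> bool) \<Rightarrow> 'a :: {semiring_0, monoid_mult} representation \<Rightarrow>
   ('i, 'a) problem \<Rightarrow> ('j, 'a) problem \<Rightarrow> ('i \<Rightarrow> bool) \<Rightarrow> bool" where
  "decidable_within T \<nu> P' P b \<longleftrightarrow>
    (\<exists>f. \<forall>orc. semiring_oracles \<nu> orc \<longrightarrow> problem_oracle \<nu> P orc \<longrightarrow>
      (\<forall>x \<in> instances P'. \<forall>cs. represents \<nu> cs (entries P' x) \<longrightarrow>
        (\<exists>Q. computes orc f cs (of_bool (b x)) Q \<and>
          (\<forall>q \<in> Q. \<exists>z \<in> instances P. represents \<nu> q (entries P z) \<and> T x z))))"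

lemma reduces_within_iff: "reduces_within T \<nu> P' P \<longleftrightarrow> decidable_within T \<nu> P' P (solvable P')"
  by (simp add: reduces_within_def decidable_within_def)

lemma computes_Comp1:
  assumes "computes orc g xs y Q" and "computes orc f [y] z R"
  shows "computes orc (Comp f [g]) xs z (Q \<union> R)"
  using comp[OF cons[OF assms(1) nil] assms(2)] by simp

lemma computes_Comp2:
  assumes "computes orc g xs y Q" and "computes orc h xs z R" and "computes orc f [y, z] w T"
  shows "computes orc (Comp f [g, h]) xs w (Q \<union> R \<union> T)"
  using comp[OF cons[OF assms(1) cons[OF assms(2) nil]] assms(3)] by simp

lemma computes_list_map:
  assumes "\<And>k. k < n \<Longrightarrow> computes orc (g (k + m)) xs (y (k + m)) {}"
  shows "computes_list orc (map g [m..<m + n]) xs (map y [m..<m + n]) {}"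
  using assms
proof (induction n arbitrary: m)
  case (Suc n)
  have "computes_list orc (map g [Suc m..<Suc m + n]) xs (map y [Suc m..<Suc m + n]) {}"
    by (rule Suc.IH) (use Suc.prems[of "Suc _"] in simp)
  moreover have "computes orc (g m) xs (y m) {}" using Suc.prems[of 0] by simp
  ultimately show ?case using cons by (fastforce simp: upt_conv_Cons simp del: upt_Suc)
qed (simp add: nil)

definition const_alg :: "nat \<Rightarrow> algorithm" where
  "const_alg c = ((\<lambda>f. Comp Succ [f]) ^^ c) Zero"

lemma computes_const: "computes orc (const_alg c) xs c {}"
proof (induction c)
  case (Suc c)
  from computes_Comp1[OF this succ] show ?case by (simp add: const_alg_def)
qed (simp add: const_alg_def zero)

lemma computable_cong:
  assumes "computable \<nu> P g" and "\<And>x. x \<in> instances P \<Longrightarrow> g x = h x"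
  shows "computable \<nu> P h"
  using assms unfolding computable_def by metis

lemma computable_entry:
  assumes "\<And>x. x \<in> instances P \<Longrightarrow> k < length (entries P x)"
  shows "computable \<nu> P (\<lambda>x. entries P x ! k)"
  unfolding computable_def
proof (intro exI[of _ "Proj k"] allI impI ballI)
  fix orc x cs assume *: "x \<in> instances P" "represents \<nu> cs (entries P x)"
  then have "k < length cs" "\<nu> (cs ! k) = Some (entries P x ! k)"
    using assms[OF *(1)] by (auto simp: represents_def list_all2_conv_all_nth)
  then show "\<exists>y. computes orc (Proj k) cs y {} \<and> \<nu> y = Some (entries P x ! k)"
    using proj by blast
qed

text \<open>
  The representation is fixed in advance, so a code of the constant can be built into the algorithm.
\<close>
lemma computable_const:
  assumes "total_representation \<nu>"
  shows "computable \<nu> P (\<lambda>_. a)"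
proof -
  obtain c where "\<nu> c = Some a" using assms by (auto simp: total_representation_def)
  with computes_const show ?thesis unfolding computable_def by blast
qed

lemma computable_binary:
  assumes "computable \<nu> P g" and "computable \<nu> P h"
    and op: "\<And>orc y z a b. semiring_oracles \<nu> orc \<Longrightarrow> \<nu> y = Some a \<Longrightarrow> \<nu> z = Some b \<Longrightarrow>
      \<exists>w. computes orc k [y, z] w {} \<and> \<nu> w = Some (op a b)"
  shows "computable \<nu> P (\<lambda>x. op (g x) (h x))"
proof -
  obtain f f' where f: "\<And>orc x cs. semiring_oracles \<nu> orc \<Longrightarrow> x \<in> instances P \<Longrightarrow>
      represents \<nu> cs (entries P x) \<Longrightarrow> \<exists>y. computes orc f cs y {} \<and> \<nu> y = Some (g x)"
    "\<And>orc x cs. semiring_oracles \<nu> orc \<Longrightarrow> x \<in> instances P \<Longrightarrow>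
      represents \<nu> cs (entries P x) \<Longrightarrow> \<exists>y. computes orc f' cs y {} \<and> \<nu> y = Some (h x)"
    using assms(1,2) unfolding computable_def by blast
  show ?thesis unfolding computable_def
  proof (intro exI[of _ "Comp k [f, f']"] allI impI ballI)
    fix orc x cs assume *: "semiring_oracles \<nu> orc" "x \<in> instances P" "represents \<nu> cs (entries P x)"
    obtain y z where y: "computes orc f cs y {}" "\<nu> y = Some (g x)"
      and z: "computes orc f' cs z {}" "\<nu> z = Some (h x)" using f(1)[OF *] f(2)[OF *] by blast
    obtain w where w: "computes orc k [y, z] w {}" "\<nu> w = Some (op (g x) (h x))"
      using op[OF *(1) y(2) z(2)] by blast
    from computes_Comp2[OF y(1) z(1) w(1)] w(2)
    show "\<exists>y. computes orc (Comp k [f, f']) cs y {} \<and> \<nu> y = Some (op (g x) (h x))" by auto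
  qed
qed

lemma computable_add:
  assumes "computable \<nu> P g" and "computable \<nu> P h"
  shows "computable \<nu> P (\<lambda>x. g x + h x)"
proof (rule computable_binary[OF assms])
  show "\<exists>w. computes orc Sum_Oracle [y, z] w {} \<and> \<nu> w = Some (a + b)"
    if "semiring_oracles \<nu> orc" "\<nu> y = Some a" "\<nu> z = Some b" for orc y z a b
    using that by (intro exI[of _ "oracle_sum orc y z"]) (simp add: sum_oracle semiring_oracles_def)
qed

lemma computable_mult:
  assumes "computable \<nu> P g" and "computable \<nu> P h"
  shows "computable \<nu> P (\<lambda>x. g x * h x)"
proof (rule computable_binary[OF assms])
  show "\<exists>w. computes orc Prod_Oracle [y, z] w {} \<and> \<nu> w = Some (a * b)"
    if "semiring_oracles \<nu> orc" "\<nu> y = Some a" "\<nu> z = Some b" for orc y z a b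
    using that by (intro exI[of _ "oracle_prod orc y z"]) (simp add: prod_oracle semiring_oracles_def)
qed

lemma computable_sum:
  assumes "total_representation \<nu>" and "\<And>k. k < (n :: nat) \<Longrightarrow> computable \<nu> P (g k)"
  shows "computable \<nu> P (\<lambda>x. \<Sum>k = 0..<n. g k x)"
  using assms(2) by (induction n) (simp_all add: computable_const[OF assms(1)] computable_add)

lemma decidable_within_cong:
  assumes "decidable_within T \<nu> P' P b" and "\<And>x. x \<in> instances P' \<Longrightarrow> b x = c x"
  shows "decidable_within T \<nu> P' P c"
  using assms unfolding decidable_within_def by (simp cong: ball_cong)

lemma decidable_within_eq:
  assumes "computable \<nu> P' g" and "computable \<nu> P' h"
  shows "decidable_within T \<nu> P' P (\<lambda>x. g x = h x)"
proof -
  obtain f f' where f: "\<And>orc x cs. semiring_oracles \<nu> orc \<Longrightarrow> x \<in> instances P' \<Longrightarrow>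
      represents \<nu> cs (entries P' x) \<Longrightarrow> \<exists>y. computes orc f cs y {} \<and> \<nu> y = Some (g x)"
    "\<And>orc x cs. semiring_oracles \<nu> orc \<Longrightarrow> x \<in> instances P' \<Longrightarrow>
      represents \<nu> cs (entries P' x) \<Longrightarrow> \<exists>y. computes orc f' cs y {} \<and> \<nu> y = Some (h x)"
    using assms unfolding computable_def by blast
  show ?thesis unfolding decidable_within_def
  proof (intro exI[of _ "Comp Eq_Oracle [f, f']"] allI impI ballI)
    fix orc x cs assume *: "semiring_oracles \<nu> orc" "x \<in> instances P'" "represents \<nu> cs (entries P' x)"
    obtain y z where y: "computes orc f cs y {}" "\<nu> y = Some (g x)"
      and z: "computes orc f' cs z {}" "\<nu> z = Some (h x)" using f(1)[OF *] f(2)[OF *] by blast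
    have "oracle_eq orc y z = (g x = h x)"
      using *(1) y(2) z(2) by (simp add: semiring_oracles_def)
    with computes_Comp2[OF y(1) z(1) eq_oracle]
    show "\<exists>Q. computes orc (Comp Eq_Oracle [f, f']) cs (of_bool (g x = h x)) Q \<and>
        (\<forall>q\<in>Q. \<exists>z\<in>instances P. represents \<nu> q (entries P z) \<and> T x z)" by auto
  qed
qed

lemma decidable_within_True: "decidable_within T \<nu> P' P (\<lambda>_. True)"
  unfolding decidable_within_def
  by (intro exI[of _ "const_alg 1"] allI impI ballI exI[of _ "{}"]) (auto intro: computes_const)

lemma decidable_within_not:
  assumes "decidable_within T \<nu> P' P b"
  shows "decidable_within T \<nu> P' P (\<lambda>x. \<not> b x)"
proof -
  obtain f where f: "\<And>orc x cs. semiring_oracles \<nu> orc \<Longrightarrow> problem_oracle \<nu> P orc \<Longrightarrow>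
      x \<in> instances P' \<Longrightarrow> represents \<nu> cs (entries P' x) \<Longrightarrow>
      \<exists>Q. computes orc f cs (of_bool (b x)) Q \<and>
        (\<forall>q \<in> Q. \<exists>z \<in> instances P. represents \<nu> q (entries P z) \<and> T x z)"
    using assms unfolding decidable_within_def by blast
  have neg: "computes orc (PrimRec (const_alg 1) Zero) [of_bool c] (of_bool (\<not> c)) {}" for orc c
  proof -
    have 0: "computes orc (PrimRec (const_alg 1) Zero) [0] 1 {}"
      by (rule rec_0[OF computes_const])
    have "computes orc (PrimRec (const_alg 1) Zero) [Suc 0] 0 ({} \<union> {})"
      by (rule rec_Suc[OF 0 zero])
    with 0 show ?thesis by (cases c) auto
  qed
  show ?thesis unfolding decidable_within_def
  proof (intro exI[of _ "Comp (PrimRec (const_alg 1) Zero) [f]"] allI impI ballI)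
    fix orc x cs assume *: "semiring_oracles \<nu> orc" "problem_oracle \<nu> P orc" "x \<in> instances P'"
      "represents \<nu> cs (entries P' x)"
    from f[OF *] obtain Q where Q: "computes orc f cs (of_bool (b x)) Q"
      "\<forall>q \<in> Q. \<exists>z \<in> instances P. represents \<nu> q (entries P z) \<and> T x z" by blast
    from computes_Comp1[OF Q(1) neg] Q(2)
    show "\<exists>Q. computes orc (Comp (PrimRec (const_alg 1) Zero) [f]) cs (of_bool (\<not> b x)) Q \<and>
        (\<forall>q\<in>Q. \<exists>z\<in>instances P. represents \<nu> q (entries P z) \<and> T x z)" by auto
  qed
qed

text \<open>
  Both questions are always evaluated; this is harmless because each of them queries admissible
  instances only, whatever the answer to the other one.
\<close>
lemma decidable_within_conj:
  assumes "decidable_within T \<nu> P' P b" and "decidable_within T \<nu> P' P c"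
  shows "decidable_within T \<nu> P' P (\<lambda>x. b x \<and> c x)"
proof -
  obtain f f' where f: "\<And>orc x cs. semiring_oracles \<nu> orc \<Longrightarrow> problem_oracle \<nu> P orc \<Longrightarrow>
      x \<in> instances P' \<Longrightarrow> represents \<nu> cs (entries P' x) \<Longrightarrow>
      \<exists>Q. computes orc f cs (of_bool (b x)) Q \<and>
        (\<forall>q \<in> Q. \<exists>z \<in> instances P. represents \<nu> q (entries P z) \<and> T x z)"
    "\<And>orc x cs. semiring_oracles \<nu> orc \<Longrightarrow> problem_oracle \<nu> P orc \<Longrightarrow>
      x \<in> instances P' \<Longrightarrow> represents \<nu> cs (entries P' x) \<Longrightarrow>
      \<exists>Q. computes orc f' cs (of_bool (c x)) Q \<and>
        (\<forall>q \<in> Q. \<exists>z \<in> instances P. represents \<nu> q (entries P z) \<and> T x z)"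
    using assms unfolding decidable_within_def by metis
  let ?g = "PrimRec Zero (Proj 2)"
  have both: "computes orc ?g [of_bool u, of_bool v] (of_bool (u \<and> v)) {}" for orc u v
  proof -
    have 0: "computes orc ?g [0, of_bool v] 0 {}" by (rule rec_0[OF zero])
    have "computes orc ?g [Suc 0, of_bool v] ([0, 0, of_bool v] ! 2) ({} \<union> {})"
      by (rule rec_Suc[OF 0 proj]) simp
    with 0 show ?thesis by (cases u) auto
  qed
  show ?thesis unfolding decidable_within_def
  proof (intro exI[of _ "Comp ?g [f, f']"] allI impI ballI)
    fix orc x cs assume *: "semiring_oracles \<nu> orc" "problem_oracle \<nu> P orc" "x \<in> instances P'"
      "represents \<nu> cs (entries P' x)"
    from f(1)[OF *] obtain Q where Q: "computes orc f cs (of_bool (b x)) Q"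
      "\<forall>q \<in> Q. \<exists>z \<in> instances P. represents \<nu> q (entries P z) \<and> T x z" by blast
    from f(2)[OF *] obtain R where R: "computes orc f' cs (of_bool (c x)) R"
      "\<forall>q \<in> R. \<exists>z \<in> instances P. represents \<nu> q (entries P z) \<and> T x z" by blast
    have "computes orc (Comp ?g [f, f']) cs (of_bool (b x \<and> c x)) (Q \<union> R)"
      using computes_Comp2[OF Q(1) R(1) both] by simp
    with Q(2) R(2)
    show "\<exists>Q. computes orc (Comp ?g [f, f']) cs (of_bool (b x \<and> c x)) Q \<and>
        (\<forall>q\<in>Q. \<exists>z\<in>instances P. represents \<nu> q (entries P z) \<and> T x z)" by blast
  qed
qed

lemma decidable_within_disj:
  assumes "decidable_within T \<nu> P' P b" and "decidable_within T \<nu> P' P c"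
  shows "decidable_within T \<nu> P' P (\<lambda>x. b x \<or> c x)"
  using decidable_within_not[OF decidable_within_conj[OF assms[THEN decidable_within_not]]] by simp

lemma decidable_within_all:
  assumes "\<And>k. k < (n :: nat) \<Longrightarrow> decidable_within T \<nu> P' P (b k)"
  shows "decidable_within T \<nu> P' P (\<lambda>x. \<forall>k < n. b k x)"
  using assms
  by (induction n) (simp_all add: decidable_within_True All_less_Suc decidable_within_conj)

lemma decidable_within_ex:
  assumes "\<And>k. k < (n :: nat) \<Longrightarrow> decidable_within T \<nu> P' P (b k)"
  shows "decidable_within T \<nu> P' P (\<lambda>x. \<exists>k < n. b k x)"
proof -
  have "decidable_within T \<nu> P' P (\<lambda>x. \<forall>k < n. \<not> b k x)"
    by (intro decidable_within_all decidable_within_not assms)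
  from decidable_within_not[OF this] show ?thesis by simp
qed

text \<open>
  The common length matters: an algorithm produces a fixed number of query arguments.
\<close>
definition computable_list ::
  "'a :: {semiring_0, monoid_mult} representation \<Rightarrow> ('i, 'a) problem \<Rightarrow> nat \<Rightarrow> ('i \<Rightarrow> 'a list) \<Rightarrow> bool"
  where
  "computable_list \<nu> P N g \<longleftrightarrow>
    (\<forall>x \<in> instances P. length (g x) = N) \<and> (\<forall>k < N. computable \<nu> P (\<lambda>x. g x ! k))"

lemma decidable_within_query:
  assumes list: "computable_list \<nu> P' N (\<lambda>x. entries P (F x))"
    and F: "\<And>x. x \<in> instances P' \<Longrightarrow> F x \<in> instances P \<and> T x (F x)"
  shows "decidable_within T \<nu> P' P (\<lambda>x. solvable P (F x))"
proof -
  have "\<forall>k. \<exists>f. k < N \<longrightarrow> (\<forall>orc. semiring_oracles \<nu> orc \<longrightarrow>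
    (\<forall>x \<in> instances P'. \<forall>cs. represents \<nu> cs (entries P' x) \<longrightarrow>
      (\<exists>y. computes orc f cs y {} \<and> \<nu> y = Some (entries P (F x) ! k))))"
    using list unfolding computable_list_def computable_def by blast
  then obtain f where f: "\<And>k orc x cs. k < N \<Longrightarrow> semiring_oracles \<nu> orc \<Longrightarrow> x \<in> instances P' \<Longrightarrow>
      represents \<nu> cs (entries P' x) \<Longrightarrow>
      \<exists>y. computes orc (f k) cs y {} \<and> \<nu> y = Some (entries P (F x) ! k)"
    by metis
  show ?thesis unfolding decidable_within_def
  proof (intro exI[of _ "Comp Query_Oracle (map f [0..<N])"] allI impI ballI)
    fix orc x cs assume *: "semiring_oracles \<nu> orc" "problem_oracle \<nu> P orc" "x \<in> instances P'"
      "represents \<nu> cs (entries P' x)"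
    have "\<forall>k. \<exists>y. k < N \<longrightarrow> computes orc (f k) cs y {} \<and> \<nu> y = Some (entries P (F x) ! k)"
      using f[OF _ *(1,3,4)] by blast
    then obtain y where y: "\<And>k. k < N \<Longrightarrow> computes orc (f k) cs (y k) {}"
      "\<And>k. k < N \<Longrightarrow> \<nu> (y k) = Some (entries P (F x) ! k)" by metis
    let ?q = "map y [0..<N]"
    have "computes_list orc (map f [0..<N]) cs ?q {}"
      using computes_list_map[of N orc f 0 cs y] y(1) by simp
    then have c: "computes orc (Comp Query_Oracle (map f [0..<N])) cs
        (of_bool (oracle_query orc ?q)) {?q}"
      using comp[OF _ query_oracle] by fastforce
    have rep: "represents \<nu> ?q (entries P (F x))"
      using list *(3) y(2) by (auto simp: represents_def list_all2_conv_all_nth computable_list_def)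
    then have "oracle_query orc ?q = solvable P (F x)"
      using *(2) F[OF *(3)] by (auto simp: problem_oracle_def)
    with c rep F[OF *(3)]
    show "\<exists>Q. computes orc (Comp Query_Oracle (map f [0..<N])) cs (of_bool (solvable P (F x))) Q \<and>
        (\<forall>q\<in>Q. \<exists>z\<in>instances P. represents \<nu> q (entries P z) \<and> T x z)" by auto
  qed
qed

lemma computable_list_entries:
  assumes "\<And>x. x \<in> instances P \<Longrightarrow> length (entries P x) = N"
  shows "computable_list \<nu> P N (entries P)"
  using assms by (auto simp: computable_list_def intro!: computable_entry)

lemma computable_list_append:
  assumes "computable_list \<nu> P N g" and "computable_list \<nu> P M h"
  shows "computable_list \<nu> P (N + M) (\<lambda>x. g x @ h x)"
  unfolding computable_list_def
proof (intro conjI ballI allI impI)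
  fix k assume k: "k < N + M"
  show "computable \<nu> P (\<lambda>x. (g x @ h x) ! k)"
  proof (cases "k < N")
    case True
    with assms(1) have "computable \<nu> P (\<lambda>x. g x ! k)" by (simp add: computable_list_def)
    then show ?thesis
      by (rule computable_cong) (use True assms(1) in \<open>simp add: computable_list_def nth_append\<close>)
  next
    case False
    with k assms(2) have "computable \<nu> P (\<lambda>x. h x ! (k - N))" by (simp add: computable_list_def)
    then show ?thesis
      by (rule computable_cong) (use False assms(1) in \<open>simp add: computable_list_def nth_append\<close>)
  qed
qed (use assms in \<open>auto simp: computable_list_def\<close>)

text \<open>
  This is how the components of an instance are recovered from the list of all its entries.
\<close>
lemma computable_list_appendD:
  assumes "computable_list \<nu> P K (\<lambda>x. g x @ h x)"
    and g: "\<And>x. x \<in> instances P \<Longrightarrow> length (g x) = N"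
    and h: "\<And>x. x \<in> instances P \<Longrightarrow> length (h x) = M"
  shows "computable_list \<nu> P N g" and "computable_list \<nu> P M h"
proof -
  have "computable \<nu> P (\<lambda>x. g x ! k)" if "k < N" for k
  proof (cases "instances P = {}")
    case False
    then have "k < K" using assms that by (fastforce simp: computable_list_def)
    with assms(1) have "computable \<nu> P (\<lambda>x. (g x @ h x) ! k)" by (simp add: computable_list_def)
    then show ?thesis by (rule computable_cong) (use g that in \<open>simp add: nth_append\<close>)
  qed (simp add: computable_def)
  with g show "computable_list \<nu> P N g" by (simp add: computable_list_def)
  have "computable \<nu> P (\<lambda>x. h x ! k)" if "k < M" for k
  proof (cases "instances P = {}")
    case False
    then have "N + k < K" using assms that by (fastforce simp: computable_list_def)
    with assms(1) have "computable \<nu> P (\<lambda>x. (g x @ h x) ! (N + k))" by (simp add: computable_list_def)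
    then show ?thesis by (rule computable_cong) (use g that in \<open>simp add: nth_append\<close>)
  qed (simp add: computable_def)
  with h show "computable_list \<nu> P M h" by (simp add: computable_list_def)
qed

lemma computable_list_cong:
  assumes "computable_list \<nu> P N g" and "\<And>x. x \<in> instances P \<Longrightarrow> g x = h x"
  shows "computable_list \<nu> P N h"
  unfolding computable_list_def
proof (intro conjI ballI allI impI)
  fix k assume "k < N"
  with assms(1) have "computable \<nu> P (\<lambda>x. g x ! k)" by (simp add: computable_list_def)
  then show "computable \<nu> P (\<lambda>x. h x ! k)" by (rule computable_cong) (simp add: assms(2))
qed (use assms in \<open>auto simp: computable_list_def\<close>)

lemma computable_list_concat:
  assumes "\<And>i. i < m \<Longrightarrow> computable_list \<nu> P N (g i)"
  shows "computable_list \<nu> P (m * N) (\<lambda>x. concat (map (\<lambda>i. g i x) [0..<m]))"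
  using assms
proof (induction m)
  case 0
  then show ?case by (simp add: computable_list_def)
next
  case (Suc m)
  from computable_list_append[OF Suc.IH Suc.prems[of m]] Suc.prems
  show ?case by (simp add: add.commute)
qed

lemma computable_list_concatD:
  assumes "computable_list \<nu> P K (\<lambda>x. concat (map (\<lambda>i. g i x) [0..<m]))"
    and "\<And>i x. i < m \<Longrightarrow> x \<in> instances P \<Longrightarrow> length (g i x) = N" and "i < m"
  shows "computable_list \<nu> P N (g i)"
  using assms
proof (induction m arbitrary: K)
  case (Suc m)
  have "computable_list \<nu> P K (\<lambda>x. concat (map (\<lambda>i. g i x) [0..<m]) @ g m x)"
    using Suc.prems(1) by simp
  moreover have "length (concat (map (\<lambda>i. g i x) [0..<m])) = m * N" if "x \<in> instances P" for x
  proof -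
    have "length (concat (map (\<lambda>i. g i x) [0..<k])) = k * N" if "k \<le> m" for k
      using that \<open>x \<in> instances P\<close> Suc.prems(2) by (induction k) simp_all
    then show ?thesis by simp
  qed
  ultimately have "computable_list \<nu> P (m * N) (\<lambda>x. concat (map (\<lambda>i. g i x) [0..<m]))"
    and last: "computable_list \<nu> P N (g m)"
    by (rule computable_list_appendD; use Suc.prems in simp)+
  from Suc.IH[OF this(1)] last Suc.prems show ?case by (cases "i = m") auto
qed simp

definition computable_mat ::
  "'a :: {semiring_0, monoid_mult} representation \<Rightarrow> ('i, 'a) problem \<Rightarrow> nat \<Rightarrow> nat \<Rightarrow>
   ('i \<Rightarrow> 'a mat) \<Rightarrow> bool" where
  "computable_mat \<nu> P m n F \<longleftrightarrow> (\<forall>x \<in> instances P. F x \<in> carrier_mat m n) \<and>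
    (\<forall>i < m. \<forall>j < n. computable \<nu> P (\<lambda>x. F x $$ (i, j)))"

lemma computable_mat_carrier:
  "computable_mat \<nu> P m n F \<Longrightarrow> x \<in> instances P \<Longrightarrow> F x \<in> carrier_mat m n"
  by (simp add: computable_mat_def)

lemma computable_mat_cong:
  assumes "computable_mat \<nu> P m n F" and "\<And>x. x \<in> instances P \<Longrightarrow> F x = G x"
  shows "computable_mat \<nu> P m n G"
  unfolding computable_mat_def
proof (intro conjI ballI allI impI)
  fix i j assume "i < m" "j < n"
  with assms(1) have "computable \<nu> P (\<lambda>x. F x $$ (i, j))" by (simp add: computable_mat_def)
  then show "computable \<nu> P (\<lambda>x. G x $$ (i, j))" by (rule computable_cong) (simp add: assms(2))
next
  fix x assume "x \<in> instances P"
  with assms show "G x \<in> carrier_mat m n" by (metis computable_mat_carrier)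
qed

lemma mat_entries_eq:
  "A \<in> carrier_mat m n \<Longrightarrow>
    mat_entries A = concat (map (\<lambda>i. map (\<lambda>j. A $$ (i, j)) [0..<n]) [0..<m])"
  by (auto simp: mat_entries_def mat_to_list_def)

lemma length_mat_entries: "A \<in> carrier_mat m n \<Longrightarrow> length (mat_entries A) = m * n"
proof -
  assume "A \<in> carrier_mat m n"
  moreover have "length (concat (map (\<lambda>i. map (\<lambda>j. A $$ (i, j)) [0..<n]) [0..<m])) = m * n"
    by (induction m) simp_all
  ultimately show ?thesis by (simp add: mat_entries_eq)
qed

lemma computable_list_mat_entries:
  assumes "computable_mat \<nu> P m n F"
  shows "computable_list \<nu> P (m * n) (\<lambda>x. mat_entries (F x))"
proof (rule computable_list_cong)
  show "computable_list \<nu> P (m * n)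
      (\<lambda>x. concat (map (\<lambda>i. map (\<lambda>j. F x $$ (i, j)) [0..<n]) [0..<m]))"
    using assms by (intro computable_list_concat) (simp add: computable_list_def computable_mat_def)
qed (use assms in \<open>auto simp: computable_mat_def mat_entries_eq\<close>)

lemma computable_mat_if_list:
  assumes "computable_list \<nu> P K (\<lambda>x. mat_entries (F x))"
    and F: "\<And>x. x \<in> instances P \<Longrightarrow> F x \<in> carrier_mat m n"
  shows "computable_mat \<nu> P m n F"
proof -
  have "computable_list \<nu> P K (\<lambda>x. concat (map (\<lambda>i. map (\<lambda>j. F x $$ (i, j)) [0..<n]) [0..<m]))"
    using assms(1) by (rule computable_list_cong) (rule mat_entries_eq[OF F])
  from computable_list_concatD[OF this, of n]
  have "computable_list \<nu> P n (\<lambda>x. map (\<lambda>j. F x $$ (i, j)) [0..<n])" if "i < m" for i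
    using that by simp
  with F show ?thesis by (simp add: computable_mat_def computable_list_def)
qed

lemma computable_mat_mat:
  assumes "\<And>i j. i < m \<Longrightarrow> j < n \<Longrightarrow> computable \<nu> P (\<lambda>x. g x (i, j))"
  shows "computable_mat \<nu> P m n (\<lambda>x. mat m n (g x))"
  using assms by (simp add: computable_mat_def)

lemma computable_mat_entry:
  "computable_mat \<nu> P m n F \<Longrightarrow> i < m \<Longrightarrow> j < n \<Longrightarrow> computable \<nu> P (\<lambda>x. F x $$ (i, j))"
  by (simp add: computable_mat_def)

lemma computable_mat_const:
  "total_representation \<nu> \<Longrightarrow> A \<in> carrier_mat m n \<Longrightarrow> computable_mat \<nu> P m n (\<lambda>_. A)"
  by (simp add: computable_mat_def computable_const)

lemma computable_mat_add:
  assumes "computable_mat \<nu> P m n F" and "computable_mat \<nu> P m n G"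
  shows "computable_mat \<nu> P m n (\<lambda>x. F x + G x)"
proof (rule computable_mat_cong)
  show "computable_mat \<nu> P m n (\<lambda>x. mat m n (\<lambda>ij. F x $$ ij + G x $$ ij))"
    by (intro computable_mat_mat computable_add computable_mat_entry[OF assms(1)]
        computable_mat_entry[OF assms(2)])
next
  fix x assume "x \<in> instances P"
  then have "F x \<in> carrier_mat m n" "G x \<in> carrier_mat m n"
    using assms by (simp_all add: computable_mat_carrier)
  then show "mat m n (\<lambda>ij. F x $$ ij + G x $$ ij) = F x + G x" by (intro eq_matI) auto
qed

lemma computable_mat_mult:
  assumes \<nu>: "total_representation \<nu>"
    and "computable_mat \<nu> P m k F" and "computable_mat \<nu> P k n G"
  shows "computable_mat \<nu> P m n (\<lambda>x. F x * G x)"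
proof (rule computable_mat_cong)
  show "computable_mat \<nu> P m n
      (\<lambda>x. mat m n (\<lambda>ij. \<Sum>l = 0..<k. F x $$ (fst ij, l) * G x $$ (l, snd ij)))"
    by (intro computable_mat_mat computable_sum[OF \<nu>] computable_mult) 
       (simp_all add: computable_mat_entry[OF assms(2)] computable_mat_entry[OF assms(3)])
next
  fix x assume "x \<in> instances P"
  then have "F x \<in> carrier_mat m k" "G x \<in> carrier_mat k n"
    using assms by (simp_all add: computable_mat_carrier)
  then show "mat m n (\<lambda>ij. \<Sum>l = 0..<k. F x $$ (fst ij, l) * G x $$ (l, snd ij)) = F x * G x"
    by (intro eq_matI) (auto simp: scalar_prod_def)
qed

lemma computable_mat_diag_one:
  assumes \<nu>: "total_representation \<nu>" and F: "computable_mat \<nu> P m n F"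
  shows "computable_mat \<nu> P (m + 1) (n + 1) (\<lambda>x. diag_one (F x))"
proof (rule computable_mat_cong)
  show "computable_mat \<nu> P (m + 1) (n + 1) (\<lambda>x. mat (m + 1) (n + 1) (\<lambda>(i, j).
      if i = 0 \<or> j = 0 then if i = j then 1 else 0 else F x $$ (i - 1, j - 1)))"
  proof (rule computable_mat_mat, goal_cases)
    case (1 i j)
    then show ?case
      by (cases "i = 0 \<or> j = 0"; cases "i = j")
        (auto simp: computable_const[OF \<nu>] computable_mat_entry[OF F])
  qed
qed (use F in \<open>auto simp: diag_one_def dest!: computable_mat_carrier intro!: eq_matI\<close>)

lemma computable_mat_row_one:
  assumes \<nu>: "total_representation \<nu>" and F: "computable_mat \<nu> P 1 n F"
  shows "computable_mat \<nu> P 1 (n + 1) (\<lambda>x. row_one (F x))"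
proof (rule computable_mat_cong)
  show "computable_mat \<nu> P 1 (n + 1) (\<lambda>x. mat 1 (n + 1) (\<lambda>(i, j).
      if j = 0 then 1 else F x $$ (i, j - 1)))"
  proof (rule computable_mat_mat, goal_cases)
    case (1 i j)
    then show ?case
      by (cases "j = 0") (auto simp: computable_const[OF \<nu>] computable_mat_entry[OF F])
  qed
qed (use F in \<open>auto simp: row_one_def dest!: computable_mat_carrier intro!: eq_matI\<close>)

definition computable_gens ::
  "'a :: {semiring_0, monoid_mult} representation \<Rightarrow> ('i, 'a) problem \<Rightarrow> nat \<Rightarrow> nat \<Rightarrow>
   ('i \<Rightarrow> 'a mat list) \<Rightarrow> bool" where
  "computable_gens \<nu> P r n G \<longleftrightarrow> (\<forall>x \<in> instances P. length (G x) = r) \<and>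
    (\<forall>l < r. computable_mat \<nu> P n n (\<lambda>x. G x ! l))"

lemma computable_gens_generators:
  "computable_gens \<nu> P r n G \<Longrightarrow> x \<in> instances P \<Longrightarrow> G x \<in> generators r n"
  using computable_mat_carrier[of \<nu> P n n "\<lambda>x. G x ! _" x]
  by (auto simp: computable_gens_def generators_def in_set_conv_nth)

lemma computable_list_gens:
  assumes "computable_gens \<nu> P r n G"
  shows "computable_list \<nu> P (r * (n * n)) (\<lambda>x. concat (map mat_entries (G x)))"
proof (rule computable_list_cong)
  show "computable_list \<nu> P (r * (n * n)) (\<lambda>x. concat (map (\<lambda>l. mat_entries (G x ! l)) [0..<r]))"
    using assms by (intro computable_list_concat computable_list_mat_entries)
      (simp add: computable_gens_def)
next
  fix x assume "x \<in> instances P"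
  with assms have "length (G x) = r" by (simp add: computable_gens_def)
  then have "map mat_entries (G x) = map (\<lambda>l. mat_entries (G x ! l)) [0..<r]"
    by (intro nth_equalityI) auto
  then show "concat (map (\<lambda>l. mat_entries (G x ! l)) [0..<r]) = concat (map mat_entries (G x))"
    by simp
qed

lemma computable_gens_if_list:
  assumes "computable_list \<nu> P K (\<lambda>x. concat (map mat_entries (G x)))"
    and G: "\<And>x. x \<in> instances P \<Longrightarrow> G x \<in> generators r n"
  shows "computable_gens \<nu> P r n G"
proof -
  have mat: "G x ! l \<in> carrier_mat n n" if "x \<in> instances P" "l < r" for x l
    using G[OF that(1)] that(2) by (auto simp: generators_def)
  have "computable_list \<nu> P K (\<lambda>x. concat (map (\<lambda>l. mat_entries (G x ! l)) [0..<r]))"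
    using assms(1)
  proof (rule computable_list_cong)
    fix x assume "x \<in> instances P"
    with G have "length (G x) = r" by (simp add: generators_def)
    then have "map mat_entries (G x) = map (\<lambda>l. mat_entries (G x ! l)) [0..<r]"
      by (intro nth_equalityI) auto
    then show "concat (map mat_entries (G x)) = concat (map (\<lambda>l. mat_entries (G x ! l)) [0..<r])"
      by simp
  qed
  from computable_list_concatD[OF this, of "n * n"]
  have "computable_list \<nu> P (n * n) (\<lambda>x. mat_entries (G x ! l))" if "l < r" for l
    using that mat by (simp add: length_mat_entries)
  then have "computable_mat \<nu> P n n (\<lambda>x. G x ! l)" if "l < r" for l
    using that mat by (intro computable_mat_if_list) auto
  with G show ?thesis by (simp add: computable_gens_def generators_def)
qed

lemma length_gens_entries:
  assumes "As \<in> generators r n"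
  shows "length (concat (map mat_entries As)) = r * (n * n)"
proof -
  have "length (concat (map mat_entries As)) = length As * (n * n)" if "set As \<subseteq> carrier_mat n n"
    using that by (induction As) (auto simp: length_mat_entries)
  with assms show ?thesis by (auto simp: generators_def)
qed


section \<open>Instances of the reachability problems\<close>

lemma solvable_MReach:
  "(As, M) \<in> instances (MReach r n) \<Longrightarrow> solvable (MReach r n) (As, M) \<longleftrightarrow> M \<in> products (set As)"
  using ex_index_words_iff[of As r n "\<lambda>P. P = M"] by (auto simp: MReach_def)

lemma solvable_VReach:
  "(As, \<alpha>, \<eta>) \<in> instances (VReach r n) \<Longrightarrow>
    solvable (VReach r n) (As, \<alpha>, \<eta>) \<longleftrightarrow> (\<exists>Q \<in> products (set As). \<alpha> * Q = \<eta>)"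
  using ex_index_words_iff[of As r n "\<lambda>P. \<alpha> * P = \<eta>"] by (auto simp: VReach_def)

lemma solvable_SReach:
  assumes "(As, \<alpha>, \<beta>, \<gamma>) \<in> instances (SReach r n)"
  shows "solvable (SReach r n) (As, \<alpha>, \<beta>, \<gamma>) \<longleftrightarrow>
    (\<exists>Q \<in> products (set As). \<alpha> * Q * \<beta> = mat 1 1 (\<lambda>_. \<gamma>))"
proof -
  have *: "As \<in> generators r n" "\<alpha> \<in> carrier_mat 1 n" "\<beta> \<in> carrier_mat n 1"
    using assms by (auto simp: SReach_def)
  have "(\<alpha> * Q * \<beta>) $$ (0, 0) = \<gamma> \<longleftrightarrow> \<alpha> * Q * \<beta> = mat 1 1 (\<lambda>_. \<gamma>)" for Q
  proof
    assume "(\<alpha> * Q * \<beta>) $$ (0, 0) = \<gamma>"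
    then show "\<alpha> * Q * \<beta> = mat 1 1 (\<lambda>_. \<gamma>)"
      using *(2,3) by (intro eq_matI) (simp_all del: index_mult_mat(1))
  next
    assume "\<alpha> * Q * \<beta> = mat 1 1 (\<lambda>_. \<gamma>)"
    then show "(\<alpha> * Q * \<beta>) $$ (0, 0) = \<gamma>" by (simp del: index_mult_mat(1))
  qed
  with ex_index_words_iff[OF *(1), of "\<lambda>P. (\<alpha> * P * \<beta>) $$ (0, 0) = \<gamma>"] show ?thesis
    by (simp add: SReach_def)
qed

lemma MReach_computable:
  assumes "instances P \<subseteq> instances (MReach r n)" and "entries P = entries (MReach r n)"
  shows "computable_gens \<nu> P r n fst" and "computable_mat \<nu> P n n snd"
proof -
  have inst: "fst x \<in> generators r n" "snd x \<in> carrier_mat n n" if "x \<in> instances P" for x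
    using assms(1) that by (auto simp: MReach_def)
  have len: "length (concat (map mat_entries (fst x))) = r * (n * n)" if "x \<in> instances P" for x
    using inst(1)[OF that] by (rule length_gens_entries)
  have "computable_list \<nu> P (r * (n * n) + n * n)
      (\<lambda>x. concat (map mat_entries (fst x)) @ mat_entries (snd x))"
    by (rule computable_list_cong[OF computable_list_entries])
      (simp_all add: assms(2) MReach_def case_prod_beta len length_mat_entries[OF inst(2)])
  then have gens: "computable_list \<nu> P (r * (n * n)) (\<lambda>x. concat (map mat_entries (fst x)))"
    and target: "computable_list \<nu> P (n * n) (\<lambda>x. mat_entries (snd x))"
    by (rule computable_list_appendD; simp add: len length_mat_entries[OF inst(2)])+
  show "computable_gens \<nu> P r n fst" by (rule computable_gens_if_list[OF gens inst(1)])
  show "computable_mat \<nu> P n n snd" by (rule computable_mat_if_list[OF target inst(2)])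
qed

lemma VReach_computable:
  assumes "instances P \<subseteq> instances (VReach r n)" and "entries P = entries (VReach r n)"
  shows "computable_gens \<nu> P r n fst" and "computable_mat \<nu> P 1 n (\<lambda>x. fst (snd x))"
    and "computable_mat \<nu> P 1 n (\<lambda>x. snd (snd x))"
proof -
  have inst: "fst x \<in> generators r n" "fst (snd x) \<in> carrier_mat 1 n"
    "snd (snd x) \<in> carrier_mat 1 n" if "x \<in> instances P" for x
    using assms(1) that by (auto simp: VReach_def)
  have len: "length (concat (map mat_entries (fst x))) = r * (n * n)" if "x \<in> instances P" for x
    using inst(1)[OF that] by (rule length_gens_entries)
  have "computable_list \<nu> P (r * (n * n) + (1 * n + 1 * n))
      (\<lambda>x. concat (map mat_entries (fst x)) @ mat_entries (fst (snd x)) @ mat_entries (snd (snd x)))"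
    by (rule computable_list_cong[OF computable_list_entries])
      (simp_all add: assms(2) VReach_def case_prod_beta len length_mat_entries[OF inst(2)]
        length_mat_entries[OF inst(3)])
  then have gens: "computable_list \<nu> P (r * (n * n)) (\<lambda>x. concat (map mat_entries (fst x)))"
    and rest: "computable_list \<nu> P (1 * n + 1 * n)
      (\<lambda>x. mat_entries (fst (snd x)) @ mat_entries (snd (snd x)))"
    by (rule computable_list_appendD;
        simp add: len length_mat_entries[OF inst(2)] length_mat_entries[OF inst(3)])+
  from rest have start: "computable_list \<nu> P (1 * n) (\<lambda>x. mat_entries (fst (snd x)))"
    and target: "computable_list \<nu> P (1 * n) (\<lambda>x. mat_entries (snd (snd x)))"
    by (rule computable_list_appendD;
        simp add: length_mat_entries[OF inst(2)] length_mat_entries[OF inst(3)])+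
  show "computable_gens \<nu> P r n fst" by (rule computable_gens_if_list[OF gens inst(1)])
  show "computable_mat \<nu> P 1 n (\<lambda>x. fst (snd x))"
    by (rule computable_mat_if_list[OF start inst(2)])
  show "computable_mat \<nu> P 1 n (\<lambda>x. snd (snd x))"
    by (rule computable_mat_if_list[OF target inst(3)])
qed

lemma SReach_computable:
  assumes "instances P \<subseteq> instances (SReach r n)" and "entries P = entries (SReach r n)"
  shows "computable_gens \<nu> P r n fst" and "computable_mat \<nu> P 1 n (\<lambda>x. fst (snd x))"
    and "computable_mat \<nu> P n 1 (\<lambda>x. fst (snd (snd x)))"
    and "computable \<nu> P (\<lambda>x. snd (snd (snd x)))"
proof -
  have inst: "fst x \<in> generators r n" "fst (snd x) \<in> carrier_mat 1 n"
    "fst (snd (snd x)) \<in> carrier_mat n 1" if "x \<in> instances P" for x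
    using assms(1) that by (auto simp: SReach_def)
  have len: "length (concat (map mat_entries (fst x))) = r * (n * n)" if "x \<in> instances P" for x
    using inst(1)[OF that] by (rule length_gens_entries)
  have "computable_list \<nu> P (r * (n * n) + (1 * n + (n * 1 + 1)))
      (\<lambda>x. concat (map mat_entries (fst x)) @ mat_entries (fst (snd x)) @
        mat_entries (fst (snd (snd x))) @ [snd (snd (snd x))])"
    by (rule computable_list_cong[OF computable_list_entries])
      (simp_all add: assms(2) SReach_def case_prod_beta len length_mat_entries[OF inst(2)]
        length_mat_entries[OF inst(3)])
  then have gens: "computable_list \<nu> P (r * (n * n)) (\<lambda>x. concat (map mat_entries (fst x)))"
    and rest: "computable_list \<nu> P (1 * n + (n * 1 + 1)) (\<lambda>x. mat_entries (fst (snd x)) @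
      mat_entries (fst (snd (snd x))) @ [snd (snd (snd x))])"
    by (rule computable_list_appendD;
        simp add: len length_mat_entries[OF inst(2)] length_mat_entries[OF inst(3)])+
  from rest have start: "computable_list \<nu> P (1 * n) (\<lambda>x. mat_entries (fst (snd x)))"
    and rest': "computable_list \<nu> P (n * 1 + 1)
      (\<lambda>x. mat_entries (fst (snd (snd x))) @ [snd (snd (snd x))])"
    by (rule computable_list_appendD;
        simp add: length_mat_entries[OF inst(2)] length_mat_entries[OF inst(3)])+
  from rest' have final: "computable_list \<nu> P (n * 1) (\<lambda>x. mat_entries (fst (snd (snd x))))"
    and target: "computable_list \<nu> P 1 (\<lambda>x. [snd (snd (snd x))])"
    by (rule computable_list_appendD; simp add: length_mat_entries[OF inst(3)])+
  show "computable_gens \<nu> P r n fst" by (rule computable_gens_if_list[OF gens inst(1)])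
  show "computable_mat \<nu> P 1 n (\<lambda>x. fst (snd x))"
    by (rule computable_mat_if_list[OF start inst(2)])
  show "computable_mat \<nu> P n 1 (\<lambda>x. fst (snd (snd x)))"
    by (rule computable_mat_if_list[OF final inst(3)])
  show "computable \<nu> P (\<lambda>x. snd (snd (snd x)))"
    using target by (simp add: computable_list_def)
qed

lemma query_MReach:
  assumes G: "computable_gens \<nu> P R N G" and M: "computable_mat \<nu> P N N M"
    and T: "\<And>x. x \<in> instances P \<Longrightarrow> T x (G x, M x)"
  shows "decidable_within T \<nu> P (MReach R N) (\<lambda>x. M x \<in> products (set (G x)))"
proof (rule decidable_within_cong)
  have inst: "(G x, M x) \<in> instances (MReach R N)" if "x \<in> instances P" for x
    using computable_gens_generators[OF G that] computable_mat_carrier[OF M that]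
    by (simp add: MReach_def)
  show "decidable_within T \<nu> P (MReach R N) (\<lambda>x. solvable (MReach R N) (G x, M x))"
  proof (rule decidable_within_query)
    show "computable_list \<nu> P (R * (N * N) + N * N) (\<lambda>x. entries (MReach R N) (G x, M x))"
      using computable_list_append[OF computable_list_gens[OF G] computable_list_mat_entries[OF M]]
      by (simp add: MReach_def)
  qed (use inst T in auto)
  show "solvable (MReach R N) (G x, M x) = (M x \<in> products (set (G x)))"
    if "x \<in> instances P" for x by (rule solvable_MReach[OF inst[OF that]])
qed

lemma query_VReach:
  assumes G: "computable_gens \<nu> P R N G" and a: "computable_mat \<nu> P 1 N a"
    and h: "computable_mat \<nu> P 1 N h"
    and T: "\<And>x. x \<in> instances P \<Longrightarrow> T x (G x, a x, h x)"
  shows "decidable_within T \<nu> P (VReach R N) (\<lambda>x. \<exists>Q \<in> products (set (G x)). a x * Q = h x)"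
proof (rule decidable_within_cong)
  have inst: "(G x, a x, h x) \<in> instances (VReach R N)" if "x \<in> instances P" for x
    using computable_gens_generators[OF G that] computable_mat_carrier[OF a that]
      computable_mat_carrier[OF h that]
    by (simp add: VReach_def)
  show "decidable_within T \<nu> P (VReach R N) (\<lambda>x. solvable (VReach R N) (G x, a x, h x))"
  proof (rule decidable_within_query)
    show "computable_list \<nu> P (R * (N * N) + (1 * N + 1 * N))
        (\<lambda>x. entries (VReach R N) (G x, a x, h x))"
      using computable_list_append[OF computable_list_gens[OF G]
          computable_list_append[OF computable_list_mat_entries[OF a] computable_list_mat_entries[OF h]]]
      by (simp add: VReach_def)
  qed (use inst T in auto)
  show "solvable (VReach R N) (G x, a x, h x) = (\<exists>Q \<in> products (set (G x)). a x * Q = h x)"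
    if "x \<in> instances P" for x by (rule solvable_VReach[OF inst[OF that]])
qed

lemma query_SReach:
  assumes G: "computable_gens \<nu> P R N G" and a: "computable_mat \<nu> P 1 N a"
    and b: "computable_mat \<nu> P N 1 b" and c: "computable \<nu> P c"
    and T: "\<And>x. x \<in> instances P \<Longrightarrow> T x (G x, a x, b x, c x)"
  shows "decidable_within T \<nu> P (SReach R N)
    (\<lambda>x. \<exists>Q \<in> products (set (G x)). a x * Q * b x = mat 1 1 (\<lambda>_. c x))"
proof (rule decidable_within_cong)
  have inst: "(G x, a x, b x, c x) \<in> instances (SReach R N)" if "x \<in> instances P" for x
    using computable_gens_generators[OF G that] computable_mat_carrier[OF a that]
      computable_mat_carrier[OF b that]
    by (simp add: SReach_def)
  have c': "computable_list \<nu> P 1 (\<lambda>x. [c x])" using c by (simp add: computable_list_def)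
  show "decidable_within T \<nu> P (SReach R N) (\<lambda>x. solvable (SReach R N) (G x, a x, b x, c x))"
  proof (rule decidable_within_query)
    show "computable_list \<nu> P (R * (N * N) + (1 * N + (N * 1 + 1)))
        (\<lambda>x. entries (SReach R N) (G x, a x, b x, c x))"
      using computable_list_append[OF computable_list_gens[OF G]
          computable_list_append[OF computable_list_mat_entries[OF a]
            computable_list_append[OF computable_list_mat_entries[OF b] c']]]
      by (simp add: SReach_def)
  qed (use inst T in auto)
  show "solvable (SReach R N) (G x, a x, b x, c x) =
      (\<exists>Q \<in> products (set (G x)). a x * Q * b x = mat 1 1 (\<lambda>_. c x))"
    if "x \<in> instances P" for x by (rule solvable_SReach[OF inst[OF that]])
qed

lemma computable_gens_map:
  assumes "computable_gens \<nu> P r n G"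
    and "\<And>F. computable_mat \<nu> P n n F \<Longrightarrow> computable_mat \<nu> P N N (\<lambda>x. H x (F x))"
  shows "computable_gens \<nu> P r N (\<lambda>x. map (H x) (G x))"
  unfolding computable_gens_def
proof (intro conjI ballI allI impI)
  fix l assume l: "l < r"
  then have "computable_mat \<nu> P N N (\<lambda>x. H x (G x ! l))"
    using assms by (simp add: computable_gens_def)
  then show "computable_mat \<nu> P N N (\<lambda>x. map (H x) (G x) ! l)"
    by (rule computable_mat_cong) (use assms(1) l in \<open>simp add: computable_gens_def\<close>)
qed (use assms(1) in \<open>simp add: computable_gens_def\<close>)

lemma computable_gens_snoc:
  assumes "computable_gens \<nu> P r n G" and "computable_mat \<nu> P n n F"
  shows "computable_gens \<nu> P (r + 1) n (\<lambda>x. G x @ [F x])"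
  unfolding computable_gens_def
proof (intro conjI ballI allI impI)
  fix l assume "l < r + 1"
  then consider "l < r" | "l = r" by linarith
  then show "computable_mat \<nu> P n n (\<lambda>x. (G x @ [F x]) ! l)"
  proof cases
    case 1
    then have "computable_mat \<nu> P n n (\<lambda>x. G x ! l)" using assms by (simp add: computable_gens_def)
    then show ?thesis
      by (rule computable_mat_cong) (use assms(1) 1 in \<open>simp add: computable_gens_def nth_append\<close>)
  next
    case 2
    from assms(2) show ?thesis
      by (rule computable_mat_cong) (use assms(1) 2 in \<open>simp add: computable_gens_def nth_append\<close>)
  qed
qed (use assms(1) in \<open>simp add: computable_gens_def\<close>)

lemma computable_gens_rotate:
  assumes "computable_gens \<nu> P r n G"
  shows "computable_gens \<nu> P r n (\<lambda>x. rotate k (G x))"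
  unfolding computable_gens_def
proof (intro conjI ballI allI impI)
  fix l assume l: "l < r"
  then have "computable_mat \<nu> P n n (\<lambda>x. G x ! ((k + l) mod r))"
    using assms by (simp add: computable_gens_def)
  then show "computable_mat \<nu> P n n (\<lambda>x. rotate k (G x) ! l)"
    by (rule computable_mat_cong) (use assms l in \<open>simp add: computable_gens_def nth_rotate\<close>)
qed (use assms in \<open>simp add: computable_gens_def\<close>)

lemma is_zero_mat_iff: "A \<in> carrier_mat m n \<Longrightarrow> is_zero_mat A \<longleftrightarrow> A = 0\<^sub>m m n"
  by (auto simp: is_zero_mat_def)

lemma decidable_within_zero_mat:
  assumes \<nu>: "total_representation \<nu>" and F: "computable_mat \<nu> P' m n F"
  shows "decidable_within T \<nu> P' P (\<lambda>x. F x = 0\<^sub>m m n)"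
proof (rule decidable_within_cong)
  show "decidable_within T \<nu> P' P (\<lambda>x. \<forall>i < m. \<forall>j < n. F x $$ (i, j) = 0)"
    by (intro decidable_within_all decidable_within_eq computable_mat_entry[OF F]
        computable_const[OF \<nu>])
next
  fix x assume "x \<in> instances P'"
  with F have "F x \<in> carrier_mat m n" by (rule computable_mat_carrier)
  then show "(\<forall>i < m. \<forall>j < n. F x $$ (i, j) = 0) = (F x = 0\<^sub>m m n)" by (auto intro!: eq_matI)
qed


section \<open>Reductions to two generators\<close>

lemma computable_mat_select:
  assumes \<nu>: "total_representation \<nu>" and G: "computable_gens \<nu> P r n G"
  shows "computable_mat \<nu> P (r * n) (r * n) (\<lambda>x. select_mat r n (G x))"
  unfolding select_mat_def
proof (rule computable_mat_mat, goal_cases)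
  case (1 i j)
  then have "i div n < r" "n > 0" by (auto simp: less_mult_imp_div_less intro: gr0I)
  then have "j < n \<Longrightarrow> computable \<nu> P (\<lambda>x. G x ! (i div n) $$ (i mod n, j))"
    using G by (intro computable_mat_entry) (auto simp: computable_gens_def)
  then show ?case by (cases "j < n") (auto simp: computable_const[OF \<nu>])
qed

lemma computable_mat_advance:
  assumes \<nu>: "total_representation \<nu>" and F: "computable_mat \<nu> P n n F"
  shows "computable_mat \<nu> P (r * n) (r * n) (\<lambda>x. advance_mat r n (F x))"
  unfolding advance_mat_def
proof (rule computable_mat_mat, goal_cases)
  case (1 i j)
  then have "i mod n < n" by (cases n) auto
  then have "j < n \<Longrightarrow> computable \<nu> P (\<lambda>x. F x $$ (i mod n, j))"
    using computable_mat_entry[OF F] by blast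
  then show ?case
    by (cases "i + n < r * n"; cases "j < n"; cases "j = i + n") (auto simp: computable_const[OF \<nu>])
qed

lemma computable_gens_two:
  assumes \<nu>: "total_representation \<nu>" and G: "computable_gens \<nu> P r n G"
    and F: "computable_mat \<nu> P n n F"
  shows "computable_gens \<nu> P 2 (r * n) (\<lambda>x. [select_mat r n (G x), advance_mat r n (F x)])"
  using computable_mat_select[OF \<nu> G] computable_mat_advance[OF \<nu> F]
  by (auto simp: computable_gens_def less_2_cases_iff)

lemma block_automatonI:
  "r \<ge> 1 \<Longrightarrow> As \<in> generators r n \<Longrightarrow> block_automaton r n As (As ! (r - 1))"
  "r \<ge> 1 \<Longrightarrow> As \<in> generators r n \<Longrightarrow> block_automaton r n As (0\<^sub>m n n)"
  "r \<ge> 1 \<Longrightarrow> As \<in> generators r n \<Longrightarrow> As ! (r - 1) \<in> set As"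
  by (auto simp: block_automaton_def generators_def subset_iff)

lemma unit_rows_block_le: "r \<ge> 1 \<Longrightarrow> n \<le> r * (n :: nat)"
  by (cases r) auto

text \<open>
  The final vector of the new instance equals \<open>\<beta>\<close> in block \<open>0\<close> and \<open>A\<^sub>0 \<beta>\<close> in all other blocks.
\<close>
lemma SReach_two_generators:
  fixes \<nu> :: "'a :: {semiring_0, monoid_mult} representation"
  assumes \<nu>: "total_representation \<nu>" and r: "r \<ge> 1"
  shows "reduces_within (\<lambda>x z. starget z = starget x) \<nu> (SReach r n) (SReach 2 (r * n))"
  unfolding reduces_within_iff
proof (rule decidable_within_cong)
  let ?P = "SReach r n :: (_, 'a) problem"
  note comp = SReach_computable[OF subset_refl refl, where \<nu> = \<nu> and r = r and n = n]
  let ?b = "\<lambda>x. mat (r * n) 1 (\<lambda>(i, j). if i < n then fst (snd (snd x)) $$ (i, j)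
    else (fst x ! 0 * fst (snd (snd x))) $$ (i mod n, j))"
  let ?R = "unit_rows (r * n) (0 * n) n"
  have last: "computable_mat \<nu> ?P n n (\<lambda>x. fst x ! l)" if "l < r" for l
    using comp(1) that by (simp add: computable_gens_def)
  have b: "computable_mat \<nu> ?P (r * n) 1 ?b"
  proof (rule computable_mat_mat, goal_cases)
    case (1 i j)
    then have n: "i mod n < n" by (cases n) auto
    have "computable_mat \<nu> ?P n 1 (\<lambda>x. fst x ! 0 * fst (snd (snd x)))"
      using computable_mat_mult[OF \<nu> last[of 0] comp(3)] r by simp
    with 1 n comp(3) show ?case by (cases "i < n") (simp_all add: computable_mat_entry)
  qed
  show "decidable_within (\<lambda>x z. starget z = starget x) \<nu> ?P (SReach 2 (r * n))
    (\<lambda>x. \<exists>Q \<in> products (set [select_mat r n (fst x), advance_mat r n (fst x ! (r - 1))]).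
      fst (snd x) * ?R * Q * ?b x = mat 1 1 (\<lambda>_. snd (snd (snd x))))"
  proof (rule query_SReach[OF _ _ b comp(4)])
    show "computable_gens \<nu> ?P 2 (r * n)
        (\<lambda>x. [select_mat r n (fst x), advance_mat r n (fst x ! (r - 1))])"
      by (rule computable_gens_two[OF \<nu> comp(1) last]) (use r in simp)
    show "computable_mat \<nu> ?P 1 (r * n) (\<lambda>x. fst (snd x) * ?R)"
      by (rule computable_mat_mult[OF \<nu> comp(2) computable_mat_const[OF \<nu>]]) simp
  qed (auto simp: starget_def)
  fix x assume x: "x \<in> instances ?P"
  obtain As \<alpha> \<beta> \<gamma> where x_eq: "x = (As, \<alpha>, \<beta>, \<gamma>)" by (cases x) auto
  have inst: "As \<in> generators r n" "\<alpha> \<in> carrier_mat 1 n" "\<beta> \<in> carrier_mat n 1"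
    using x by (auto simp: x_eq SReach_def)
  note aut = block_automatonI[OF r inst(1)]
  let ?R' = "\<lambda>s. unit_rows (r * n) (s * n) n :: 'a mat"
  have "As ! 0 \<in> set As" using inst(1) r by (auto simp: generators_def)
  then have A0: "As ! 0 \<in> carrier_mat n n" using inst(1) by (auto simp: generators_def)
  have b0: "?R' 0 * ?b x = \<beta>"
  proof -
    have lt: "i < r * n" if "i < n" for i
      using unit_rows_block_le[OF r, of n] that by linarith
    show ?thesis
      by (subst unit_rows_mult)
        (use inst(3) unit_rows_block_le[OF r, of n] in \<open>auto simp: x_eq lt intro!: eq_matI\<close>)
  qed
  have bs: "?R' s * ?b x = As ! 0 * \<beta>" if "0 < s" "s < r" for s
  proof -
    have le: "n \<le> s * n" "s * n + n \<le> r * n"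
      using that block_automaton.block_le[OF aut(1) that(2)] by (cases s; simp)+
    then have lt: "s * n + i < r * n" "\<not> s * n + i < n" if "i < n" for i
      using that by linarith+
    show ?thesis
      by (subst unit_rows_mult) (use inst(3) A0 le in \<open>auto simp: x_eq lt intro!: eq_matI\<close>)
  qed
  have "?b x \<in> carrier_mat (r * n) 1" by simp
  from block_automaton.scalar_reach_iff[OF aut(1,3) inst(2,3) this b0 bs]
  show "(\<exists>Q \<in> products (set [select_mat r n (fst x), advance_mat r n (fst x ! (r - 1))]).
      fst (snd x) * ?R * Q * ?b x = mat 1 1 (\<lambda>_. snd (snd (snd x)))) = solvable ?P x"
    using solvable_SReach[of As \<alpha> \<beta> \<gamma> r n] x by (simp add: x_eq)
qed

lemma VReach_two_generators:
  fixes \<nu> :: "'a :: {semiring_0, monoid_mult} representation"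
  assumes \<nu>: "total_representation \<nu>" and r: "r \<ge> 1"
  shows "reduces_within (\<lambda>x z. is_zero_mat (vtarget z) \<longleftrightarrow> is_zero_mat (vtarget x)) \<nu>
    (VReach r n) (VReach 2 (r * n))"
  unfolding reduces_within_iff
proof (rule decidable_within_cong)
  let ?P = "VReach r n :: (_, 'a) problem"
  note comp = VReach_computable[OF subset_refl refl, where \<nu> = \<nu> and r = r and n = n]
  let ?R = "unit_rows (r * n) (0 * n) n"
  have last: "computable_mat \<nu> ?P n n (\<lambda>x. fst x ! l)" if "l < r" for l
    using comp(1) that by (simp add: computable_gens_def)
  have zero: "is_zero_mat (snd (snd x) * ?R) \<longleftrightarrow> is_zero_mat (snd (snd x))"
    if "x \<in> instances ?P" for x
  proof -
    obtain As \<alpha> \<eta> where x_eq: "x = (As, \<alpha>, \<eta>)" by (cases x) auto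
    have inst: "As \<in> generators r n" "\<eta> \<in> carrier_mat 1 n" using that by (auto simp: x_eq VReach_def)
    have "\<eta> * ?R = 0\<^sub>m 1 n * ?R \<longleftrightarrow> \<eta> = 0\<^sub>m 1 n"
      using block_automaton.block_row_eq_iff[OF block_automatonI(1)[OF r inst(1)] inst(2),
          of "0\<^sub>m 1 n" 0 0] r
      by auto
    with inst(2) show ?thesis
      by (simp add: x_eq is_zero_mat_iff[of _ 1 "r * n"] is_zero_mat_iff[of _ 1 n])
  qed
  show "decidable_within (\<lambda>x z. is_zero_mat (vtarget z) \<longleftrightarrow> is_zero_mat (vtarget x)) \<nu> ?P
      (VReach 2 (r * n))
    (\<lambda>x. \<exists>Q \<in> products (set [select_mat r n (fst x), advance_mat r n (fst x ! (r - 1))]).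
      fst (snd x) * ?R * Q = snd (snd x) * ?R)"
  proof (rule query_VReach)
    show "computable_gens \<nu> ?P 2 (r * n)
        (\<lambda>x. [select_mat r n (fst x), advance_mat r n (fst x ! (r - 1))])"
      by (rule computable_gens_two[OF \<nu> comp(1) last]) (use r in simp)
    show "computable_mat \<nu> ?P 1 (r * n) (\<lambda>x. fst (snd x) * ?R)"
      by (rule computable_mat_mult[OF \<nu> comp(2) computable_mat_const[OF \<nu>]]) simp
    show "computable_mat \<nu> ?P 1 (r * n) (\<lambda>x. snd (snd x) * ?R)"
      by (rule computable_mat_mult[OF \<nu> comp(3) computable_mat_const[OF \<nu>]]) simp
  qed (use zero in \<open>auto simp: vtarget_def case_prod_beta\<close>)
  fix x assume x: "x \<in> instances ?P"
  obtain As \<alpha> \<eta> where x_eq: "x = (As, \<alpha>, \<eta>)" by (cases x) auto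
  have inst: "As \<in> generators r n" "\<alpha> \<in> carrier_mat 1 n" "\<eta> \<in> carrier_mat 1 n"
    using x by (auto simp: x_eq VReach_def)
  note aut = block_automatonI[OF r inst(1)]
  from block_automaton.vector_reach_iff[OF aut(1,3) inst(2,3)]
  show "(\<exists>Q \<in> products (set [select_mat r n (fst x), advance_mat r n (fst x ! (r - 1))]).
      fst (snd x) * ?R * Q = snd (snd x) * ?R) = solvable ?P x"
    using solvable_VReach[of As \<alpha> \<eta> r n] x by (simp add: x_eq)
qed

text \<open>
  The generator list \<open>?cycle\<close> (with \<open>B = A\<^sub>r\<^sub>-\<^sub>1\<close>) decides the zero target and the lists \<open>?stop l\<close>
  (with \<open>B = 0\<close>) the nonzero ones. They cannot replace each other: if \<open>B = 0\<close> then \<open>Y\<^sup>r = 0\<close> meets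
  the zero target in any case, whereas with \<open>?cycle\<close> the block rows other than the first need not vanish. All queries place \<open>M\<close> in the
  upper left block of a zero matrix, hence preserve the zero or nonzero character of the target.
\<close>
lemma MReach_two_generators:
  fixes \<nu> :: "'a :: {semiring_0, monoid_mult} representation"
  assumes \<nu>: "total_representation \<nu>" and r: "r \<ge> 1" and n: "n \<ge> 1"
    and nontrivial: "(0 :: 'a) \<noteq> 1"
  shows "reduces_within (\<lambda>x z. is_zero_mat (mtarget z) \<longleftrightarrow> is_zero_mat (mtarget x)) \<nu>
    (MReach r n) (MReach 2 (r * n))"
  unfolding reduces_within_iff
proof (rule decidable_within_cong)
  let ?P = "MReach r n :: (_, 'a) problem"
  let ?T = "\<lambda>x z. is_zero_mat (mtarget z) \<longleftrightarrow> is_zero_mat (mtarget x)"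
  note comp = MReach_computable[OF subset_refl refl, where \<nu> = \<nu> and r = r and n = n]
  let ?R = "unit_rows (r * n) (0 * n) n" and ?C = "unit_cols (r * n) (0 * n) n"
  let ?M = "\<lambda>x. ?C * snd x * ?R"
  let ?cycle = "\<lambda>x. [select_mat r n (fst x), advance_mat r n (fst x ! (r - 1))]"
  let ?stop = "\<lambda>l x. [select_mat r n (rotate (Suc l) (fst x)), advance_mat r n (0\<^sub>m n n)]"
  have last: "computable_mat \<nu> ?P n n (\<lambda>x. fst x ! l)" if "l < r" for l
    using comp(1) that by (simp add: computable_gens_def)
  have zero: "?M x = 0\<^sub>m (r * n) (r * n) \<longleftrightarrow> snd x = 0\<^sub>m n n" if "x \<in> instances ?P" for x
  proof
    have M: "snd x \<in> carrier_mat n n" using that by (auto simp: MReach_def)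
    note [simp] = carrier_matD[OF M]
    assume *: "?M x = 0\<^sub>m (r * n) (r * n)"
    have "snd x = ?R * ?M x * ?C"
      using unit_rows_block_le[OF r]
      by (simp add: mult_mat_assoc unit_rows_mult_unit_cols unit_rows_mult_unit_cols_mult)
    then show "snd x = 0\<^sub>m n n" unfolding * by simp
  qed simp
  have zero': "is_zero_mat (?M x) \<longleftrightarrow> is_zero_mat (snd x)" if "x \<in> instances ?P" for x
    using zero[OF that] that by (auto simp: is_zero_mat_def MReach_def)
  have M: "computable_mat \<nu> ?P (r * n) (r * n) ?M"
    by (rule computable_mat_mult[OF \<nu> computable_mat_mult[OF \<nu> computable_mat_const[OF \<nu>] comp(2)]
          computable_mat_const[OF \<nu>]]) simp_all
  show "decidable_within ?T \<nu> ?P (MReach 2 (r * n))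
    (\<lambda>x. snd x = 0\<^sub>m n n \<and> ?M x \<in> products (set (?cycle x)) \<or>
      \<not> snd x = 0\<^sub>m n n \<and> (\<exists>l < r. ?M x \<in> products (set (?stop l x))))"
  proof (intro decidable_within_disj decidable_within_conj decidable_within_not decidable_within_ex
      decidable_within_zero_mat[OF \<nu> comp(2)])
    have "computable_gens \<nu> ?P 2 (r * n) ?cycle"
      by (rule computable_gens_two[OF \<nu> comp(1) last]) (use r in simp)
    then show "decidable_within ?T \<nu> ?P (MReach 2 (r * n)) (\<lambda>x. ?M x \<in> products (set (?cycle x)))"
      by (rule query_MReach[OF _ M]) (use zero' in \<open>auto simp: mtarget_def case_prod_beta\<close>)
    fix l
    have "computable_gens \<nu> ?P 2 (r * n) (?stop l)"
      by (rule computable_gens_two[OF \<nu> computable_gens_rotate[OF comp(1)] computable_mat_const[OF \<nu>]])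
        simp
    then show "decidable_within ?T \<nu> ?P (MReach 2 (r * n)) (\<lambda>x. ?M x \<in> products (set (?stop l x)))"
      by (rule query_MReach[OF _ M]) (use zero' in \<open>auto simp: mtarget_def case_prod_beta\<close>)
  qed
  fix x assume x: "x \<in> instances ?P"
  obtain As M where x_eq: "x = (As, M)" by (cases x) auto
  have inst: "As \<in> generators r n" "M \<in> carrier_mat n n" using x by (auto simp: x_eq MReach_def)
  have rot: "rotate l As \<in> generators r n" for l using inst(1) by (simp add: generators_def)
  note aut = block_automatonI[OF r inst(1)] and aut' = block_automatonI[OF r rot]
  note corner_def = block_automaton.blk'_def[OF aut(1)] block_automaton.blk'_def[OF aut'(2)]
  have "M \<in> products (set As) \<longleftrightarrow> ?M x \<in> products (set (?cycle x))" if "M = 0\<^sub>m n n"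
    using block_automaton.mortality_iff[OF aut(1,3) n nontrivial] zero[OF x] that
    by (simp add: x_eq)
  moreover have "M \<in> products (set As) \<longleftrightarrow> (\<exists>l < r. ?M x \<in> products (set (?stop l x)))"
    if nz: "M \<noteq> 0\<^sub>m n n"
  proof
    assume "\<exists>l < r. ?M x \<in> products (set (?stop l x))"
    then obtain l where "?M x \<in> products (set (?stop l x))" by blast
    with block_automaton.corner_sound[OF aut'(2) refl inst(2) nz, of "Suc l"]
    show "M \<in> products (set As)" by (simp add: x_eq corner_def)
  next
    assume "M \<in> products (set As)"
    then obtain A where A: "A \<in> set As" "M = A \<or> (\<exists>Q \<in> products (set As). M = A * Q)"
      by cases auto
    then obtain l where l: "l < r" "A = As ! l"
      using inst(1) by (auto simp: generators_def in_set_conv_nth)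
    (* rotating by l + 1 moves the first factor A = As ! l to the last position *)
    have "(Suc l + (r - 1)) mod r = l" using l by simp
    then have "rotate (Suc l) As ! (r - 1) = A"
      using l inst(1) r by (simp add: generators_def nth_rotate del: rotate_Suc)
    with A(2) have "M = rotate (Suc l) As ! (r - 1) \<or>
        (\<exists>Q \<in> products (set (rotate (Suc l) As)). M = rotate (Suc l) As ! (r - 1) * Q)"
      by (simp del: rotate_Suc)
    from block_automaton.corner_complete[OF aut'(2) refl this]
    have "?M x \<in> products (set (?stop l x))" by (simp add: x_eq corner_def del: rotate_Suc)
    with l(1) show "\<exists>l < r. ?M x \<in> products (set (?stop l x))" by blast
  qed
  ultimately show "(snd x = 0\<^sub>m n n \<and> ?M x \<in> products (set (?cycle x)) \<or>
      \<not> snd x = 0\<^sub>m n n \<and> (\<exists>l < r. ?M x \<in> products (set (?stop l x)))) = solvable ?P x"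
    using solvable_MReach[of As M r n] x by (cases "M = 0\<^sub>m n n") (simp_all add: x_eq)
qed


section \<open>Reductions between the problems\<close>

lemma borderI:
  "\<alpha> \<in> carrier_mat p n \<Longrightarrow> \<beta> \<in> carrier_mat n q \<Longrightarrow> border p n q \<alpha> \<beta>"
  by (simp add: border_def)

text \<open>
  Each lemma of this context turns a question about \<open>products (set (G x))\<close> into a single query with the
  bordered generators; the borders have sizes \<open>p\<close> and \<open>q\<close>, either of which may be \<open>0\<close>.
\<close>
context
  fixes \<nu> :: "'a :: {semiring_0, monoid_mult} representation"
    and P :: "('i, 'a) problem" and r p n q :: nat
    and G :: "'i \<Rightarrow> 'a mat list" and a b :: "'i \<Rightarrow> 'a mat"
  assumes \<nu>: "total_representation \<nu>"
    and G: "computable_gens \<nu> P r n G"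
    and a: "computable_mat \<nu> P p n a" and b: "computable_mat \<nu> P n q b"
begin

lemma computable_border_exit: "computable_mat \<nu> P n (p + n + q) (\<lambda>x. border_exit p n q (b x))"
  unfolding border_exit_def
  by (rule computable_mat_add[OF computable_mat_const[OF \<nu>]
        computable_mat_mult[OF \<nu> b computable_mat_const[OF \<nu>]]]) simp_all

lemma computable_border_entry: "computable_mat \<nu> P (p + n + q) n (\<lambda>x. border_entry p n q (a x))"
  unfolding border_entry_def
  by (rule computable_mat_add[OF computable_mat_mult[OF \<nu> computable_mat_const[OF \<nu>] a]
        computable_mat_const[OF \<nu>]]) simp_all

definition bordered_gens :: "'i \<Rightarrow> 'a mat list" where
  "bordered_gens x =
    map (\<lambda>A. border_entry p n q (a x) * A * border_exit p n q (b x)) (G x) @ [border_switch p n q]"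

lemma computable_bordered_gens: "computable_gens \<nu> P (r + 1) (p + n + q) bordered_gens"
  unfolding bordered_gens_def
proof (rule computable_gens_snoc[OF computable_gens_map[OF G]])
  show "computable_mat \<nu> P (p + n + q) (p + n + q)
      (\<lambda>x. border_entry p n q (a x) * F x * border_exit p n q (b x))"
    if "computable_mat \<nu> P n n F" for F
    by (rule computable_mat_mult[OF \<nu> computable_mat_mult[OF \<nu> computable_border_entry that]
          computable_border_exit])
  show "computable_mat \<nu> P (p + n + q) (p + n + q) (\<lambda>x. border_switch p n q)"
    by (rule computable_mat_const[OF \<nu>]) (rule carrier_matI; simp add: border_switch_def)
qed

lemma set_bordered_gens:
  "set (bordered_gens x) = insert (border_switch p n q)
    ((\<lambda>A. border_entry p n q (a x) * A * border_exit p n q (b x)) ` set (G x))"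
  by (auto simp: bordered_gens_def)

lemma gens_carrier: "x \<in> instances P \<Longrightarrow> set (G x) \<subseteq> carrier_mat n n"
  using computable_gens_generators[OF G] by (simp add: generators_def)

lemma decidable_by_matrix_target:
  assumes h: "computable_mat \<nu> P p q h" and nz: "\<And>x. x \<in> instances P \<Longrightarrow> h x \<noteq> 0\<^sub>m p q"
  shows "decidable_within (\<lambda>x z. True) \<nu> P (MReach (r + 1) (p + n + q))
    (\<lambda>x. \<exists>Q \<in> products (set (G x)). a x * Q * b x = h x)"
proof (rule decidable_within_cong[OF query_MReach[OF computable_bordered_gens]])
  let ?C = "unit_cols (p + n + q) 0 p" and ?R = "unit_rows (p + n + q) (p + n) q"
  show "computable_mat \<nu> P (p + n + q) (p + n + q) (\<lambda>x. ?C * h x * ?R)"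
    by (rule computable_mat_mult[OF \<nu> computable_mat_mult[OF \<nu> computable_mat_const[OF \<nu>] h]
          computable_mat_const[OF \<nu>]]) simp_all
  fix x assume x: "x \<in> instances P"
  from border.matrix_target_iff[OF borderI[OF computable_mat_carrier[OF a x]
        computable_mat_carrier[OF b x]] gens_carrier[OF x] computable_mat_carrier[OF h x] nz[OF x]]
  show "(?C * h x * ?R \<in> products (set (bordered_gens x))) =
      (\<exists>Q \<in> products (set (G x)). a x * Q * b x = h x)"
    by (simp add: set_bordered_gens)
qed simp

lemma decidable_by_exit_target:
  assumes h: "computable_mat \<nu> P p n h" and nz: "\<And>x. x \<in> instances P \<Longrightarrow> h x \<noteq> 0\<^sub>m p n"
  shows "decidable_within (\<lambda>x z. True) \<nu> P (MReach (r + 1) (p + n + q))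
    (\<lambda>x. \<exists>Q \<in> products (set (G x)). a x * Q = h x)"
proof (rule decidable_within_cong[OF query_MReach[OF computable_bordered_gens]])
  let ?C = "unit_cols (p + n + q) 0 p"
  show "computable_mat \<nu> P (p + n + q) (p + n + q) (\<lambda>x. ?C * h x * border_exit p n q (b x))"
    by (rule computable_mat_mult[OF \<nu> computable_mat_mult[OF \<nu> computable_mat_const[OF \<nu>] h]
          computable_border_exit]) simp_all
  fix x assume x: "x \<in> instances P"
  from border.matrix_target_exit_iff[OF borderI[OF computable_mat_carrier[OF a x]
        computable_mat_carrier[OF b x]] gens_carrier[OF x] computable_mat_carrier[OF h x] nz[OF x]]
  show "(?C * h x * border_exit p n q (b x) \<in> products (set (bordered_gens x))) =
      (\<exists>Q \<in> products (set (G x)). a x * Q = h x)"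
    by (simp add: set_bordered_gens)
qed simp

lemma decidable_by_vector_target:
  assumes c: "computable_mat \<nu> P 1 n c"
    and h: "computable_mat \<nu> P 1 q h" and nz: "\<And>x. x \<in> instances P \<Longrightarrow> h x \<noteq> 0\<^sub>m 1 q"
  shows "decidable_within (\<lambda>x z. True) \<nu> P (VReach (r + 1) (p + n + q))
    (\<lambda>x. \<exists>Q \<in> products (set (G x)). c x * Q * b x = h x)"
proof (rule decidable_within_cong[OF query_VReach[OF computable_bordered_gens]])
  let ?M = "unit_rows (p + n + q) p n" and ?R = "unit_rows (p + n + q) (p + n) q"
  show "computable_mat \<nu> P 1 (p + n + q) (\<lambda>x. c x * ?M)"
    by (rule computable_mat_mult[OF \<nu> c computable_mat_const[OF \<nu>]]) simp
  show "computable_mat \<nu> P 1 (p + n + q) (\<lambda>x. h x * ?R)"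
    by (rule computable_mat_mult[OF \<nu> h computable_mat_const[OF \<nu>]]) simp
  fix x assume x: "x \<in> instances P"
  from border.vector_target_iff[OF borderI[OF computable_mat_carrier[OF a x]
        computable_mat_carrier[OF b x]] gens_carrier[OF x] computable_mat_carrier[OF c x]
        computable_mat_carrier[OF h x] nz[OF x]]
  show "(\<exists>Q \<in> products (set (bordered_gens x)). c x * ?M * Q = h x * ?R) =
      (\<exists>Q \<in> products (set (G x)). c x * Q * b x = h x)"
    by (simp add: set_bordered_gens)
qed simp

end

lemma restrict_to_simps [simp]:
  "instances (restrict_to P T) = {x \<in> instances P. T x}"
  "entries (restrict_to P T) = entries P" "solvable (restrict_to P T) = solvable P"
  by (simp_all add: restrict_to_def)

lemma products_diag_one_iff:
  fixes S :: "'a :: {semiring_0, monoid_mult} mat set"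
  assumes "S \<subseteq> carrier_mat n n"
  shows "(\<exists>Q \<in> products (diag_one ` S). R Q) \<longleftrightarrow> (\<exists>Q \<in> products S. R (diag_one Q))"
  using products_diag_one[OF assms] by auto

text \<open>
  Borders \<open>p = 1\<close> and \<open>q = 0\<close>.
\<close>
lemma VReach_to_MReach_nonzero:
  fixes \<nu> :: "'a :: {semiring_0, monoid_mult} representation"
  assumes \<nu>: "total_representation \<nu>"
  shows "reduces_to \<nu> (restrict_to (VReach r n) (\<lambda>x. \<not> is_zero_mat (vtarget x)))
    (MReach (r + 1) (n + 1))"
  unfolding reduces_to_def reduces_within_iff
proof (rule decidable_within_cong)
  let ?P = "restrict_to (VReach r n :: (_, 'a) problem) (\<lambda>x. \<not> is_zero_mat (vtarget x))"
  have sub: "instances ?P \<subseteq> instances (VReach r n)" "entries ?P = entries (VReach r n)" by auto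
  note comp = VReach_computable[OF sub, where \<nu> = \<nu>]
  have nz: "snd (snd x) \<noteq> 0\<^sub>m 1 n" if "x \<in> instances ?P" for x
    using that by (auto simp: is_zero_mat_def vtarget_def case_prod_beta)
  have empty: "computable_mat \<nu> ?P n 0 (\<lambda>_. 0\<^sub>m n 0)" by (rule computable_mat_const[OF \<nu>]) simp
  from decidable_by_exit_target[OF \<nu> comp(1,2) empty comp(3) nz]
  show "decidable_within (\<lambda>x z. True) \<nu> ?P (MReach (r + 1) (n + 1))
      (\<lambda>x. \<exists>Q \<in> products (set (fst x)). fst (snd x) * Q = snd (snd x))" by simp
  fix x assume "x \<in> instances ?P"
  then show "(\<exists>Q \<in> products (set (fst x)). fst (snd x) * Q = snd (snd x)) = solvable ?P x"
    by (cases x) (simp add: solvable_VReach)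
qed

text \<open>
  Direct sums with \<open>1\<close> turn \<open>\<alpha>\<close> into a matrix with two rows and \<open>n\<close> into \<open>n + 1\<close>, so \<open>p = 2\<close>, \<open>q = 0\<close> and
  the new dimension is \<open>2 + (n + 1)\<close>.
\<close>
lemma VReach_to_MReach_zero:
  fixes \<nu> :: "'a :: {semiring_0, monoid_mult} representation"
  assumes \<nu>: "total_representation \<nu>" and nontrivial: "(0 :: 'a) \<noteq> 1"
  shows "reduces_to \<nu> (restrict_to (VReach r n) (\<lambda>x. is_zero_mat (vtarget x)))
    (MReach (r + 1) (n + 3))"
  unfolding reduces_to_def reduces_within_iff
proof (rule decidable_within_cong)
  let ?P = "restrict_to (VReach r n :: (_, 'a) problem) (\<lambda>x. is_zero_mat (vtarget x))"
  have sub: "instances ?P \<subseteq> instances (VReach r n)" "entries ?P = entries (VReach r n)" by auto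
  note comp = VReach_computable[OF sub, where \<nu> = \<nu>]
  note diag = computable_mat_diag_one[OF \<nu>]
  have empty: "computable_mat \<nu> ?P (n + 1) 0 (\<lambda>_. 0\<^sub>m (n + 1) 0)"
    by (rule computable_mat_const[OF \<nu>]) simp
  have nz: "diag_one (snd (snd x)) \<noteq> 0\<^sub>m (1 + 1) (n + 1)" if "x \<in> instances ?P" for x
    by (rule one_entry_nonzero(1)[OF nontrivial computable_mat_carrier[OF comp(3) that]])
  have dim: "1 + 1 + (n + 1) + 0 = n + 3" by simp
  from decidable_by_exit_target[OF \<nu> computable_gens_map[OF comp(1) diag] diag[OF comp(2)] empty
      diag[OF comp(3)] nz]
  show "decidable_within (\<lambda>x z. True) \<nu> ?P (MReach (r + 1) (n + 3))
      (\<lambda>x. \<exists>Q \<in> products (set (map diag_one (fst x))).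
        diag_one (fst (snd x)) * Q = diag_one (snd (snd x)))" unfolding dim .
  fix x assume x: "x \<in> instances ?P"
  obtain As \<alpha> \<eta> where x_eq: "x = (As, \<alpha>, \<eta>)" by (cases x) auto
  have inst: "set As \<subseteq> carrier_mat n n" "\<alpha> \<in> carrier_mat 1 n" "\<eta> \<in> carrier_mat 1 n"
    using x by (auto simp: x_eq VReach_def generators_def)
  have "diag_one \<alpha> * diag_one Q = diag_one \<eta> \<longleftrightarrow> \<alpha> * Q = \<eta>" if "Q \<in> products (set As)" for Q
    using products_carrier[OF inst(1) that] inst
    by (simp add: diag_one_mult[of _ 1 n _ n] diag_one_inject[of _ 1 n])
  then show "(\<exists>Q \<in> products (set (map diag_one (fst x))).
      diag_one (fst (snd x)) * Q = diag_one (snd (snd x))) = solvable ?P x"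
    using solvable_VReach[of As \<alpha> \<eta> r n] x by (simp add: x_eq products_diag_one_iff[OF inst(1)])
qed

lemma computable_mat_scalar:
  "computable \<nu> P c \<Longrightarrow> computable_mat \<nu> P 1 1 (\<lambda>x. mat 1 1 (\<lambda>_. c x))"
  by (rule computable_mat_mat)

lemma scalar_mat_eq_zero_iff: "mat 1 1 (\<lambda>_. c) = 0\<^sub>m 1 1 \<longleftrightarrow> c = 0"
proof
  assume "mat 1 1 (\<lambda>_. c) = 0\<^sub>m 1 1"
  then have "mat 1 1 (\<lambda>_. c) $$ (0, 0) = 0\<^sub>m 1 1 $$ (0, 0)" by simp
  then show "c = 0" by simp
qed auto

text \<open>
  A vector target needs only the lower border (\<open>p = 0\<close>, \<open>q = 1\<close>), a matrix target needs both
  (\<open>p = q = 1\<close>).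
\<close>
lemma SReach_nonzero:
  fixes \<nu> :: "'a :: {semiring_0, monoid_mult} representation"
  assumes \<nu>: "total_representation \<nu>"
  shows "reduces_to \<nu> (restrict_to (SReach r n) (\<lambda>x. starget x \<noteq> 0)) (VReach (r + 1) (n + 1))"
    and "reduces_to \<nu> (restrict_to (SReach r n) (\<lambda>x. starget x \<noteq> 0)) (MReach (r + 1) (n + 2))"
proof -
  let ?P = "restrict_to (SReach r n :: (_, 'a) problem) (\<lambda>x. starget x \<noteq> 0)"
  let ?b = "\<lambda>x. \<exists>Q \<in> products (set (fst x)). fst (snd x) * Q * fst (snd (snd x))
    = mat 1 1 (\<lambda>_. snd (snd (snd x)))"
  have sub: "instances ?P \<subseteq> instances (SReach r n)" "entries ?P = entries (SReach r n)" by auto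
  note comp = SReach_computable[OF sub, where \<nu> = \<nu>]
  note target = computable_mat_scalar[OF comp(4)]
  have nz: "mat 1 1 (\<lambda>_. snd (snd (snd x))) \<noteq> 0\<^sub>m 1 1" if "x \<in> instances ?P" for x
    using that unfolding scalar_mat_eq_zero_iff by (auto simp: starget_def case_prod_beta)
  have empty: "computable_mat \<nu> ?P 0 n (\<lambda>_. 0\<^sub>m 0 n)" by (rule computable_mat_const[OF \<nu>]) simp
  have b: "?b x = solvable ?P x" if "x \<in> instances ?P" for x
    using that by (cases x) (simp add: solvable_SReach)
  have dim: "0 + n + 1 = n + 1" "1 + n + 1 = n + 2" by simp_all
  note V = decidable_by_vector_target[OF \<nu> comp(1) empty comp(3) comp(2) target nz, unfolded dim]
  show "reduces_to \<nu> ?P (VReach (r + 1) (n + 1))"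
    unfolding reduces_to_def reduces_within_iff by (rule decidable_within_cong[OF V b])
  note M = decidable_by_matrix_target[OF \<nu> comp(1-3) target nz, unfolded dim]
  show "reduces_to \<nu> ?P (MReach (r + 1) (n + 2))"
    unfolding reduces_to_def reduces_within_iff by (rule decidable_within_cong[OF M b])
qed

text \<open>
  For a vector target the start vector gains an entry \<open>1\<close> but remains a row, and only \<open>\<beta>\<close> becomes the
  direct sum \<open>1 \<oplus> \<beta>\<close>: \<open>p = 0\<close>, \<open>q = 2\<close>, of dimension \<open>(n + 1) + 2\<close>. For a matrix target \<open>p = q = 2\<close>
  gives \<open>2 + (n + 1) + 2\<close>.
\<close>
lemma SReach_zero:
  fixes \<nu> :: "'a :: {semiring_0, monoid_mult} representation"
  assumes \<nu>: "total_representation \<nu>" and nontrivial: "(0 :: 'a) \<noteq> 1"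
  shows "reduces_to \<nu> (restrict_to (SReach r n) (\<lambda>x. starget x = 0)) (VReach (r + 1) (n + 3))"
    and "reduces_to \<nu> (restrict_to (SReach r n) (\<lambda>x. starget x = 0)) (MReach (r + 1) (n + 5))"
proof -
  let ?P = "restrict_to (SReach r n :: (_, 'a) problem) (\<lambda>x. starget x = 0)"
  let ?\<gamma> = "\<lambda>x. mat 1 1 (\<lambda>_. snd (snd (snd x))) :: 'a mat"
  have sub: "instances ?P \<subseteq> instances (SReach r n)" "entries ?P = entries (SReach r n)" by auto
  note comp = SReach_computable[OF sub, where \<nu> = \<nu>]
  note diag = computable_mat_diag_one[OF \<nu>] and row = computable_mat_row_one[OF \<nu>]
  note target = computable_mat_scalar[OF comp(4)]
  note gens = computable_gens_map[OF comp(1) diag]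
  have empty: "computable_mat \<nu> ?P 0 (n + 1) (\<lambda>_. 0\<^sub>m 0 (n + 1))"
    by (rule computable_mat_const[OF \<nu>]) simp
  have nzd: "diag_one (?\<gamma> x) \<noteq> 0\<^sub>m (1 + 1) (1 + 1)" if "x \<in> instances ?P" for x
    by (rule one_entry_nonzero(1)[OF nontrivial]) simp
  have nzr: "row_one (?\<gamma> x) \<noteq> 0\<^sub>m 1 (1 + 1)" if "x \<in> instances ?P" for x
    by (rule one_entry_nonzero(2)[OF nontrivial]) simp
  have dim: "0 + (n + 1) + (1 + 1) = n + 3" "1 + 1 + (n + 1) + (1 + 1) = n + 5" by simp_all
  have d: "(\<exists>Q \<in> products (set (map diag_one (fst x))).
        diag_one (fst (snd x)) * Q * diag_one (fst (snd (snd x))) = diag_one (?\<gamma> x))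
      = solvable ?P x" (is ?d)
    and r: "(\<exists>Q \<in> products (set (map diag_one (fst x))).
        row_one (fst (snd x)) * Q * diag_one (fst (snd (snd x))) = row_one (?\<gamma> x))
      = solvable ?P x" (is ?r)
    if x: "x \<in> instances ?P" for x
  proof -
    obtain As \<alpha> \<beta> \<gamma> where x_eq: "x = (As, \<alpha>, \<beta>, \<gamma>)" by (cases x) auto
    have inst: "set As \<subseteq> carrier_mat n n" "\<alpha> \<in> carrier_mat 1 n" "\<beta> \<in> carrier_mat n 1"
      using x by (auto simp: x_eq SReach_def generators_def)
    let ?g = "mat 1 1 (\<lambda>_. \<gamma>) :: 'a mat"
    have eq: "diag_one \<alpha> * diag_one Q * diag_one \<beta> = diag_one ?g \<longleftrightarrow> \<alpha> * Q * \<beta> = ?g"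
      "row_one \<alpha> * diag_one Q * diag_one \<beta> = row_one ?g \<longleftrightarrow> \<alpha> * Q * \<beta> = ?g"
      if "Q \<in> products (set As)" for Q
    proof -
      have Q: "Q \<in> carrier_mat n n" by (rule products_carrier[OF inst(1) that])
      have \<alpha>Q: "\<alpha> * Q \<in> carrier_mat 1 n" using inst Q by simp
      have g: "\<alpha> * Q * \<beta> \<in> carrier_mat 1 1" "?g \<in> carrier_mat 1 1" using \<alpha>Q inst by simp_all
      show "diag_one \<alpha> * diag_one Q * diag_one \<beta> = diag_one ?g \<longleftrightarrow> \<alpha> * Q * \<beta> = ?g"
        by (simp only: diag_one_mult[OF inst(2) Q] diag_one_mult[OF \<alpha>Q inst(3)]
            diag_one_inject[OF g])
      show "row_one \<alpha> * diag_one Q * diag_one \<beta> = row_one ?g \<longleftrightarrow> \<alpha> * Q * \<beta> = ?g"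
        by (simp only: row_one_mult[OF inst(2) Q] row_one_mult[OF \<alpha>Q inst(3)]
            row_one_inject[OF g])
    qed
    have s: "solvable ?P x \<longleftrightarrow> (\<exists>Q \<in> products (set As). \<alpha> * Q * \<beta> = ?g)"
      using solvable_SReach[of As \<alpha> \<beta> \<gamma> r n] x by (simp add: x_eq)
    show ?d unfolding s unfolding x_eq using eq(1) by (simp add: products_diag_one_iff[OF inst(1)])
    show ?r unfolding s unfolding x_eq using eq(2) by (simp add: products_diag_one_iff[OF inst(1)])
  qed
  note V = decidable_by_vector_target[OF \<nu> gens empty diag[OF comp(3)] row[OF comp(2)]
      row[OF target] nzr, unfolded dim]
  show "reduces_to \<nu> ?P (VReach (r + 1) (n + 3))"
    unfolding reduces_to_def reduces_within_iff by (rule decidable_within_cong[OF V r])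
  note M = decidable_by_matrix_target[OF \<nu> gens diag[OF comp(2)] diag[OF comp(3)]
      diag[OF target] nzd, unfolded dim]
  show "reduces_to \<nu> ?P (MReach (r + 1) (n + 5))"
    unfolding reduces_to_def reduces_within_iff by (rule decidable_within_cong[OF M d])
qed


section \<open>The trivial semiring and the theorem\<close>
lemma trivial_semiring_solvable:
  assumes trivial: "(0 :: 'a :: {semiring_0, monoid_mult}) = 1" and r: "r \<ge> 1"
  shows "x \<in> instances (MReach r n :: (_, 'a) problem) \<Longrightarrow> solvable (MReach r n) x"
    and "y \<in> instances (VReach r n :: (_, 'a) problem) \<Longrightarrow> solvable (VReach r n) y"
    and "z \<in> instances (SReach r n :: (_, 'a) problem) \<Longrightarrow> solvable (SReach r n) z"
proof -
  have eq: "u = v" for u v :: 'a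
    using trivial by (metis mult_1_left mult_zero_left)
  have mat_eq: "A = B" if "A \<in> carrier_mat m k" "B \<in> carrier_mat m k" for A B :: "'a mat" and m k
    using that eq by (intro eq_matI) auto
  have hd: "As ! 0 \<in> products (set As)" "As ! 0 \<in> carrier_mat n n"
    if "As \<in> generators r n" for As :: "'a mat list"
  proof -
    have "As ! 0 \<in> set As" using that r by (auto simp: generators_def)
    then show "As ! 0 \<in> products (set As)" "As ! 0 \<in> carrier_mat n n"
      using that by (auto simp: generators_def intro: products.base)
  qed
  show "solvable (MReach r n) x" if x: "x \<in> instances (MReach r n :: (_, 'a) problem)"
  proof (cases x)
    case (Pair As M)
    with x have "As \<in> generators r n" "M \<in> carrier_mat n n" by (auto simp: MReach_def)
    with hd[of As] mat_eq[of M n n "As ! 0"] have "M \<in> products (set As)" by simp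
    with x Pair show ?thesis by (simp add: solvable_MReach)
  qed
  show "solvable (VReach r n) y" if y: "y \<in> instances (VReach r n :: (_, 'a) problem)"
  proof (cases y)
    case (fields As \<alpha> \<eta>)
    with y have i: "As \<in> generators r n" "\<alpha> \<in> carrier_mat 1 n" "\<eta> \<in> carrier_mat 1 n"
      by (auto simp: VReach_def)
    then have "\<alpha> * As ! 0 = \<eta>" using hd(2) by (intro mat_eq[of _ 1 n]) auto
    with y fields hd(1)[OF i(1)] show ?thesis by (auto simp: solvable_VReach)
  qed
  show "solvable (SReach r n) z" if z: "z \<in> instances (SReach r n :: (_, 'a) problem)"
  proof (cases z)
    case (fields As \<alpha> \<beta> \<gamma>)
    with z have i: "As \<in> generators r n" by (auto simp: SReach_def)
    have "\<exists>P \<in> products (set As). (\<alpha> * P * \<beta>) $$ (0, 0) = \<gamma>" using hd(1)[OF i] eq by blast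
    with ex_index_words_iff[OF i, of "\<lambda>P. (\<alpha> * P * \<beta>) $$ (0, 0) = \<gamma>"] show ?thesis
      by (simp add: fields SReach_def)
  qed
qed

lemma reduces_to_if_reduces_within: "reduces_within T \<nu> P' P \<Longrightarrow> reduces_to \<nu> P' P"
  unfolding reduces_to_def reduces_within_def by meson

lemma reduces_within_if_solvable:
  assumes "\<And>x. x \<in> instances P' \<Longrightarrow> solvable P' x"
  shows "reduces_within T \<nu> P' P"
  unfolding reduces_within_iff
  by (rule decidable_within_cong[OF decidable_within_True]) (simp add: assms)

theorem theorem1:
  fixes \<nu> :: "'a :: {semiring_0, monoid_mult} representation"
    and r n :: nat
  assumes "total_representation \<nu>"
    and "r \<ge> 1" and "n \<ge> 1"
  shows
    "reduces_to \<nu> (SReach r n) (SReach 2 (r * n)) \<and>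
     reduces_to \<nu> (VReach r n) (VReach 2 (r * n)) \<and>
     reduces_to \<nu> (MReach r n) (MReach 2 (r * n)) \<and>
     reduces_to \<nu> (restrict_to (VReach r n) (\<lambda>x. \<not> is_zero_mat (vtarget x)))
       (MReach (r + 1) (n + 1)) \<and>
     reduces_to \<nu> (restrict_to (VReach r n) (\<lambda>x. is_zero_mat (vtarget x)))
       (MReach (r + 1) (n + 3)) \<and>
     reduces_to \<nu> (restrict_to (SReach r n) (\<lambda>x. starget x \<noteq> 0))
       (VReach (r + 1) (n + 1)) \<and>
     reduces_to \<nu> (restrict_to (SReach r n) (\<lambda>x. starget x = 0))
       (VReach (r + 1) (n + 3)) \<and>
     reduces_to \<nu> (restrict_to (SReach r n) (\<lambda>x. starget x \<noteq> 0))
       (MReach (r + 1) (n + 2)) \<and>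
     reduces_to \<nu> (restrict_to (SReach r n) (\<lambda>x. starget x = 0))
       (MReach (r + 1) (n + 5)) \<and>
     reduces_within (\<lambda>x z. starget z = starget x) \<nu> (SReach r n) (SReach 2 (r * n)) \<and>
     reduces_within (\<lambda>x z. is_zero_mat (vtarget z) \<longleftrightarrow> is_zero_mat (vtarget x)) \<nu>
       (VReach r n) (VReach 2 (r * n)) \<and>
     reduces_within (\<lambda>x z. is_zero_mat (mtarget z) \<longleftrightarrow> is_zero_mat (mtarget x)) \<nu>
       (MReach r n) (MReach 2 (r * n))"
proof (cases "(0 :: 'a) = 1")
  case True
  note trivial = trivial_semiring_solvable[OF True assms(2)]
  show ?thesis
    unfolding reduces_to_def
    by (intro conjI reduces_within_if_solvable) (auto intro: trivial)
next
  case False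
  note S = SReach_two_generators[OF assms(1,2)]
    and V = VReach_two_generators[OF assms(1,2)]
    and M = MReach_two_generators[OF assms False]
  show ?thesis
    by (intro conjI S V M S[THEN reduces_to_if_reduces_within] V[THEN reduces_to_if_reduces_within]
        M[THEN reduces_to_if_reduces_within] VReach_to_MReach_nonzero[OF assms(1)]
        VReach_to_MReach_zero[OF assms(1) False] SReach_nonzero[OF assms(1)]
        SReach_zero[OF assms(1) False])
qed

end
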